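(* The 2BTL generators act as follows on the vectors $b_p$ (written simply $p$) of the basis $\mathbf B_1$ of $W^{(N)}(b)$, where $p=(h_0,h_1,\dots,h_N)$ runs over all paths. (1) Left boundary: if $h_1=-1$ then $e_0\cdot p=\frac{[\omega_1]}{[\omega_1+1]}\,p$; if $h_1=1$ then $e_0\cdot p=0$. (2) Bulk ($1\le i\le N-1$): if $p$ has a slope at $i$, i.e. $h_{i+1}=h_{i-1}\pm2$, then $e_i\cdot p=0$. If $p'$ is obtained from $p$ by the addition of a single tile at point $i$, then on the ordered basis $(p,p')$ (matrices act on column vectors, i.e. the columns are the images of $p$ and $p'$) $$e_i=\begin{pmatrix} r(\omega_1-h_{i-1}) & r(\omega_1-h_{i-1})\,r(-\omega_1+h_{i-1})\\ 1& r(-\omega_1+h_{i-1})\end{pmatrix}\ \text{ if }h_{i-1}\ge0,$$ $$e_i=\begin{pmatrix} r(-\omega_1+h_{i-1}) & r(\omega_1-h_{i-1})\,r(-\omega_1+h_{i-1})\\ 1& r(\omega_1-h_{i-1})\end{pmatrix}\ \text{ if }h_{i-1}<0.$$ (3) Right boundary: if $p'$ is obtained from $p$ by the addition of a right boundary half-tile, then on $(p,p')$ $$e_N=\begin{pmatrix} k(\omega_1-h_{N-1}) & k(\omega_1-h_{N-1})\,k(-\omega_1+h_{N-1})\\ 1& k(-\omega_1+h_{N-1})\end{pmatrix}\ \text{ if }h_{N-1}\ge0,$$ $$e_N=\begin{pmatrix} k(-\omega_1+h_{N-1}) & k(\omega_1-h_{N-1})\,k(-\omega_1+h_{N-1})\\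 1& k(\omega_1-h_{N-1})\end{pmatrix}\ \text{ if }h_{N-1}<0.$$
   Context: Let $N\ge2$. Fix complex numbers $\eta,\omega_1,\omega_2,\theta$; write $q^x=e^{\eta x}$ and $[x]=\frac{q^x-q^{-x}}{q-q^{-1}}$. Assume genericity: $q$ is not a root of unity, $[\omega_1-m]\neq0$ for all $m\in\mathbb Z$, and $[\omega_2],[\omega_2+1]\ne0$. Put $\delta=[2]$, $s_1=\frac{[\omega_1]}{[\omega_1+1]}$, $s_2=\frac{[\omega_2]}{[\omega_2+1]}$. The 2BTL algebra is the unital complex algebra with generators $e_0,\dots,e_N$ and relations $e_i^2=\delta e_i$, $e_ie_{i\pm1}e_i=e_i$ for $1\le i\le N-1$ (with $i\pm1\in\{0,\dots,N\}$), $e_0^2=s_1e_0$, $e_N^2=s_2e_N$, $e_ie_j=e_je_i$ for $|i-j|>1$. For $N$ even set $I_1=e_1e_3\cdots e_{N-1}$, $I_2=e_0e_2\cdots e_N$ and $b=\frac{[(\omega_1+\omega_2+1+\theta)/2][(\omega_1+\omega_2+1-\theta)/2]}{[\omega_1+1][\omega_2+1]}$; for $N$ odd set $I_1=e_1e_3\cdots e_N$, $I_2=e_0e_2\cdots e_{N-1}$ and $b=-\frac{[(\omega_1-\omega_2+\theta)/2][(\omega_1-\omega_2-\theta)/2]}{[\omega_1+1][\omega_2+1]}$. The double quotient $\mathcal A_b$ is the quotient of 2BTL by $I_1I_2I_1=bI_1$, $I_2I_1I_2=bI_2$. Define $E_0=1$ and $E_i=s_1^{(-1)^i}E_{i-1}e_{i-1}E_{i-1}$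 for $1\le i\le N$ (idempotents). The $2^N$-dimensional module $W^{(N)}(b)$ is realised as the left ideal $\mathcal A_bE_N$. Put $r(u)=\frac{[u+1]}{[u]}$, $k(u)=-\frac{[(u-\omega_2+\theta)/2][(u-\omega_2-\theta)/2]}{[u][\omega_2+1]}$, $R_i(u)=e_i-r(u)$, $K_N(u)=e_N-k(u)$. A path is $p=(h_0,\dots,h_N)$ with $h_0=0$, $h_{i+1}-h_i=\pm1$. The fundamental path is $p_0=(0,-1,0,-1,0,\dots)$. A path $p'$ is obtained from $p$ by adding a tile at point $i$ ($1\le i\le N-1$) if they agree except at $i$, $h_{i-1}=h_{i+1}$, and: either $h_{i-1}\ge0$, $h_i=h_{i-1}-1$, $h_i'=h_{i-1}+1$ (tile added from above), or $h_{i-1}<0$, $h_i=h_{i-1}+1$, $h'_i=h_{i-1}-1$ (tile added from below). It is obtained by adding a right boundary half-tile if they agree except at $N$ and the same conditions hold with $i=N$ (omitting the condition on $h_{i+1}$). Every path is obtained from $p_0$ by successive additions. The basis $\mathbf B_1=\{b_p\}$ of $W^{(N)}(b)$ is defined by $b_{p_0}=E_N$ and $b_{p'}=X_ib_p$ when $p'$ is obtained from $p$ by adding a tile or half-tile at $i$, where: from above, $X_i=R_i(\omega_1-h_{i-1})$ for $i<N$, and $X_N=K_N(\omega_1-h_{N-1})$; from below, $X_i=R_i(-\omega_1+h_{i-1})$ for $i<N$, and $X_N=K_N(-\omega_1+h_{N-1})$. (This is independent of the order of additions.) *)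

theory Defs
  imports Complex_Main "HOL-Algebra.QuotRing" "HOL-Library.Poly_Mapping"
begin

section \<open>Scalars\<close>

definition qnum :: "complex \<Rightarrow> complex \<Rightarrow> complex" where
  "qnum \<eta> x = (exp (\<eta> * x) - exp (- (\<eta> * x))) / (exp \<eta> - exp (- \<eta>))"

definition loop_weight :: "complex \<Rightarrow> complex \<Rightarrow> complex" where
  "loop_weight \<eta> \<omega> = qnum \<eta> \<omega> / qnum \<eta> (\<omega> + 1)"

definition b_weight :: "nat \<Rightarrow> complex \<Rightarrow> complex \<Rightarrow> complex \<Rightarrow> complex \<Rightarrow> complex" where
  "b_weight N \<eta> \<omega>1 \<omega>2 \<theta> =
    (if even N
     then qnum \<eta> ((\<omega>1 + \<omega>2 + 1 + \<theta>) / 2) * qnum \<eta> ((\<omega>1 + \<omega>2 + 1 - \<theta>) / 2)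
            / (qnum \<eta> (\<omega>1 + 1) * qnum \<eta> (\<omega>2 + 1))
     else - (qnum \<eta> ((\<omega>1 - \<omega>2 + \<theta>) / 2) * qnum \<eta> ((\<omega>1 - \<omega>2 - \<theta>) / 2)
            / (qnum \<eta> (\<omega>1 + 1) * qnum \<eta> (\<omega>2 + 1))))"

definition r_fun :: "complex \<Rightarrow> complex \<Rightarrow> complex" where
  "r_fun \<eta> u = qnum \<eta> (u + 1) / qnum \<eta> u"

definition k_fun :: "complex \<Rightarrow> complex \<Rightarrow> complex \<Rightarrow> complex \<Rightarrow> complex" where
  "k_fun \<eta> \<omega>2 \<theta> u =
    - (qnum \<eta> ((u - \<omega>2 + \<theta>) / 2) * qnum \<eta> ((u - \<omega>2 - \<theta>) / 2)
        / (qnum \<eta> u * qnum \<eta> (\<omega>2 + 1)))"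


section \<open>The free unital algebra on \<open>e\<^sub>0, \<dots>, e\<^sub>N\<close>\<close>

text \<open>
  Noncommutative polynomials are finitely supported functions on words. Words are wrapped in
  a type of their own so that concatenation makes them an instance of \<^class>\<open>monoid_add\<close>;
  the product of \<^type>\<open>poly_mapping\<close> is then the product of the free algebra.
\<close>

datatype word = Word (letters: "nat list")

instantiation word :: monoid_add
begin
definition "0 = Word []"
definition "v + w = Word (letters v @ letters w)"
instance by standard (auto simp: zero_word_def plus_word_def)
end

type_synonym ncpoly = "word \<Rightarrow>\<^sub>0 complex"

definition fgen :: "nat \<Rightarrow> ncpoly" where
  "fgen i = Poly_Mapping.single (Word [i]) 1"

definition fconst :: "complex \<Rightarrow> ncpoly" where
  "fconst c = Poly_Mapping.single 0 c"

definition free_algebra :: "nat \<Rightarrow> ncpoly ring" where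
  "free_algebra N =
    \<lparr>carrier = {f. \<forall>w\<in>Poly_Mapping.keys f. set (letters w) \<subseteq> {..N}},
     mult = (*), one = 1, zero = 0, add = (+)\<rparr>"


section \<open>The algebra 2BTL and its double quotient\<close>

definition tbtl_relations :: "nat \<Rightarrow> complex \<Rightarrow> complex \<Rightarrow> complex \<Rightarrow> ncpoly set" where
  "tbtl_relations N \<eta> \<omega>1 \<omega>2 =
     {fgen i * fgen i - fconst (qnum \<eta> 2) * fgen i | i. 1 \<le> i \<and> i \<le> N - 1}
   \<union> {fgen i * fgen j * fgen i - fgen i | i j. 1 \<le> i \<and> i \<le> N - 1 \<and> (j = i + 1 \<or> i = j + 1)}
   \<union> {fgen 0 * fgen 0 - fconst (loop_weight \<eta> \<omega>1) * fgen 0,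
      fgen N * fgen N - fconst (loop_weight \<eta> \<omega>2) * fgen N}
   \<union> {fgen i * fgen j - fgen j * fgen i | i j. i \<le> N \<and> j \<le> N \<and> (i + 1 < j \<or> j + 1 < i)}"

definition tbtl_ideal :: "nat \<Rightarrow> complex \<Rightarrow> complex \<Rightarrow> complex \<Rightarrow> ncpoly set" where
  "tbtl_ideal N \<eta> \<omega>1 \<omega>2 = genideal (free_algebra N) (tbtl_relations N \<eta> \<omega>1 \<omega>2)"

definition tbtl :: "nat \<Rightarrow> complex \<Rightarrow> complex \<Rightarrow> complex \<Rightarrow> ncpoly set ring" where
  "tbtl N \<eta> \<omega>1 \<omega>2 = free_algebra N Quot tbtl_ideal N \<eta> \<omega>1 \<omega>2"

definition tbtl_class :: "nat \<Rightarrow> complex \<Rightarrow> complex \<Rightarrow> complex \<Rightarrow> ncpoly \<Rightarrow> ncpoly set" where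
  "tbtl_class N \<eta> \<omega>1 \<omega>2 f = tbtl_ideal N \<eta> \<omega>1 \<omega>2 +>\<^bsub>free_algebra N\<^esub> f"

text \<open>
  For both parities of \<open>N\<close>, \<open>I\<^sub>1\<close> and \<open>I\<^sub>2\<close> are the products, in increasing order, of the
  generators with odd and with even index in \<open>{0..N}\<close>.
\<close>

definition I1_word :: "nat \<Rightarrow> ncpoly" where
  "I1_word N = prod_list (map fgen (filter odd [0..<Suc N]))"

definition I2_word :: "nat \<Rightarrow> ncpoly" where
  "I2_word N = prod_list (map fgen (filter even [0..<Suc N]))"

definition dq_relations ::
  "nat \<Rightarrow> complex \<Rightarrow> complex \<Rightarrow> complex \<Rightarrow> complex \<Rightarrow> ncpoly set set" where
  "dq_relations N \<eta> \<omega>1 \<omega>2 \<theta> =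
    (let I1 = I1_word N; I2 = I2_word N; b = fconst (b_weight N \<eta> \<omega>1 \<omega>2 \<theta>) in
     tbtl_class N \<eta> \<omega>1 \<omega>2 ` {I1 * I2 * I1 - b * I1, I2 * I1 * I2 - b * I2})"

definition dq_ideal ::
  "nat \<Rightarrow> complex \<Rightarrow> complex \<Rightarrow> complex \<Rightarrow> complex \<Rightarrow> ncpoly set set" where
  "dq_ideal N \<eta> \<omega>1 \<omega>2 \<theta> = genideal (tbtl N \<eta> \<omega>1 \<omega>2) (dq_relations N \<eta> \<omega>1 \<omega>2 \<theta>)"

definition dq ::
  "nat \<Rightarrow> complex \<Rightarrow> complex \<Rightarrow> complex \<Rightarrow> complex \<Rightarrow> ncpoly set set ring" where
  "dq N \<eta> \<omega>1 \<omega>2 \<theta> = tbtl N \<eta> \<omega>1 \<omega>2 Quot dq_ideal N \<eta> \<omega>1 \<omega>2 \<theta>"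

definition dq_class ::
  "nat \<Rightarrow> complex \<Rightarrow> complex \<Rightarrow> complex \<Rightarrow> complex \<Rightarrow> ncpoly \<Rightarrow> ncpoly set set" where
  "dq_class N \<eta> \<omega>1 \<omega>2 \<theta> f =
    dq_ideal N \<eta> \<omega>1 \<omega>2 \<theta> +>\<^bsub>tbtl N \<eta> \<omega>1 \<omega>2\<^esub> tbtl_class N \<eta> \<omega>1 \<omega>2 f"

definition dq_gen ::
  "nat \<Rightarrow> complex \<Rightarrow> complex \<Rightarrow> complex \<Rightarrow> complex \<Rightarrow> nat \<Rightarrow> ncpoly set set" where
  "dq_gen N \<eta> \<omega>1 \<omega>2 \<theta> i = dq_class N \<eta> \<omega>1 \<omega>2 \<theta> (fgen i)"

definition dq_const ::
  "nat \<Rightarrow> complex \<Rightarrow> complex \<Rightarrow> complex \<Rightarrow> complex \<Rightarrow> complex \<Rightarrow> ncpoly set set" where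
  "dq_const N \<eta> \<omega>1 \<omega>2 \<theta> c = dq_class N \<eta> \<omega>1 \<omega>2 \<theta> (fconst c)"

text \<open>
  The complex algebra structure: scalars act through the images of the constant polynomials,
  which are central (\<open>dq_const_central\<close>).
\<close>

definition dq_scale ::
  "nat \<Rightarrow> complex \<Rightarrow> complex \<Rightarrow> complex \<Rightarrow> complex \<Rightarrow> complex \<Rightarrow> ncpoly set set \<Rightarrow> ncpoly set set"
  where
  "dq_scale N \<eta> \<omega>1 \<omega>2 \<theta> c x = dq_const N \<eta> \<omega>1 \<omega>2 \<theta> c \<otimes>\<^bsub>dq N \<eta> \<omega>1 \<omega>2 \<theta>\<^esub> x"


section \<open>The module \<open>W\<close>\<close>

primrec idem ::
  "nat \<Rightarrow> complex \<Rightarrow> complex \<Rightarrow> complex \<Rightarrow> complex \<Rightarrow> nat \<Rightarrow> ncpoly set set" where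
  "idem N \<eta> \<omega>1 \<omega>2 \<theta> 0 = \<one>\<^bsub>dq N \<eta> \<omega>1 \<omega>2 \<theta>\<^esub>"
| "idem N \<eta> \<omega>1 \<omega>2 \<theta> (Suc i) =
    dq_scale N \<eta> \<omega>1 \<omega>2 \<theta> (loop_weight \<eta> \<omega>1 powi ((- 1) ^ Suc i))
      (idem N \<eta> \<omega>1 \<omega>2 \<theta> i \<otimes>\<^bsub>dq N \<eta> \<omega>1 \<omega>2 \<theta>\<^esub> dq_gen N \<eta> \<omega>1 \<omega>2 \<theta> i
        \<otimes>\<^bsub>dq N \<eta> \<omega>1 \<omega>2 \<theta>\<^esub> idem N \<eta> \<omega>1 \<omega>2 \<theta> i)"

definition W_module ::
  "nat \<Rightarrow> complex \<Rightarrow> complex \<Rightarrow> complex \<Rightarrow> complex \<Rightarrow> ncpoly set set set" where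
  "W_module N \<eta> \<omega>1 \<omega>2 \<theta> =
    {a \<otimes>\<^bsub>dq N \<eta> \<omega>1 \<omega>2 \<theta>\<^esub> idem N \<eta> \<omega>1 \<omega>2 \<theta> N | a. a \<in> carrier (dq N \<eta> \<omega>1 \<omega>2 \<theta>)}"


section \<open>Paths\<close>

text \<open>A path \<open>(h\<^sub>0, \<dots>, h\<^sub>N)\<close> is the list of its heights.\<close>

definition is_path :: "nat \<Rightarrow> int list \<Rightarrow> bool" where
  "is_path N p \<longleftrightarrow> length p = Suc N \<and> p ! 0 = 0 \<and>
     (\<forall>i<N. p ! Suc i - p ! i = 1 \<or> p ! Suc i - p ! i = - 1)"

definition fund_path :: "nat \<Rightarrow> int list" where
  "fund_path N = map (\<lambda>i. if even i then 0 else - 1) [0..<Suc N]"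

text \<open>\<open>flips a h h'\<close>: next to a point of height \<open>a\<close>, the height is changed from \<open>h\<close> to \<open>h'\<close> by
  adding a (half-)tile from above, if \<open>a \<ge> 0\<close>, or from below, if \<open>a < 0\<close>.\<close>

definition flips :: "int \<Rightarrow> int \<Rightarrow> int \<Rightarrow> bool" where
  "flips a h h' \<longleftrightarrow> (a \<ge> 0 \<and> h = a - 1 \<and> h' = a + 1) \<or> (a < 0 \<and> h = a + 1 \<and> h' = a - 1)"

definition adds_tile :: "nat \<Rightarrow> nat \<Rightarrow> int list \<Rightarrow> int list \<Rightarrow> bool" where
  "adds_tile N i p p' \<longleftrightarrow> is_path N p \<and> is_path N p' \<and> 1 \<le> i \<and> i \<le> N - 1 \<and>
     (\<forall>j\<le>N. j \<noteq> i \<longrightarrow> p' ! j = p ! j) \<and>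
     p ! (i - 1) = p ! (i + 1) \<and> flips (p ! (i - 1)) (p ! i) (p' ! i)"

definition adds_half_tile :: "nat \<Rightarrow> int list \<Rightarrow> int list \<Rightarrow> bool" where
  "adds_half_tile N p p' \<longleftrightarrow> is_path N p \<and> is_path N p' \<and>
     (\<forall>j\<le>N. j \<noteq> N \<longrightarrow> p' ! j = p ! j) \<and>
     flips (p ! (N - 1)) (p ! N) (p' ! N)"


section \<open>The basis \<open>B\<^sub>1\<close>\<close>

text \<open>
  In \<open>R_op\<close> and \<open>K_op\<close> the subtracted scalar is read as that multiple of the unit.
\<close>

definition R_op ::
  "nat \<Rightarrow> complex \<Rightarrow> complex \<Rightarrow> complex \<Rightarrow> complex \<Rightarrow> nat \<Rightarrow> complex \<Rightarrow> ncpoly set set" where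
  "R_op N \<eta> \<omega>1 \<omega>2 \<theta> i u =
    dq_gen N \<eta> \<omega>1 \<omega>2 \<theta> i \<ominus>\<^bsub>dq N \<eta> \<omega>1 \<omega>2 \<theta>\<^esub> dq_const N \<eta> \<omega>1 \<omega>2 \<theta> (r_fun \<eta> u)"

definition K_op ::
  "nat \<Rightarrow> complex \<Rightarrow> complex \<Rightarrow> complex \<Rightarrow> complex \<Rightarrow> complex \<Rightarrow> ncpoly set set" where
  "K_op N \<eta> \<omega>1 \<omega>2 \<theta> u =
    dq_gen N \<eta> \<omega>1 \<omega>2 \<theta> N \<ominus>\<^bsub>dq N \<eta> \<omega>1 \<omega>2 \<theta>\<^esub> dq_const N \<eta> \<omega>1 \<omega>2 \<theta> (k_fun \<eta> \<omega>2 \<theta> u)"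

definition tile_arg :: "complex \<Rightarrow> int \<Rightarrow> complex" where
  "tile_arg \<omega>1 h = (if h \<ge> 0 then \<omega>1 - of_int h else - \<omega>1 + of_int h)"

text \<open>\<open>basis_rel \<dots> p v\<close>: the vector \<open>v\<close> is obtained from \<open>E\<^sub>N\<close> along some sequence of
  additions leading from the fundamental path to \<open>p\<close>. The lemma \<open>basis_rel_ex1\<close> below shows that
  there is exactly one such \<open>v\<close> for every path \<open>p\<close>.\<close>

inductive basis_rel ::
  "nat \<Rightarrow> complex \<Rightarrow> complex \<Rightarrow> complex \<Rightarrow> complex \<Rightarrow> int list \<Rightarrow> ncpoly set set \<Rightarrow> bool"
  for N \<eta> \<omega>1 \<omega>2 \<theta> where
  start: "basis_rel N \<eta> \<omega>1 \<omega>2 \<theta> (fund_path N) (idem N \<eta> \<omega>1 \<omega>2 \<theta> N)"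
| tile: "basis_rel N \<eta> \<omega>1 \<omega>2 \<theta> p v \<Longrightarrow> adds_tile N i p p' \<Longrightarrow>
    basis_rel N \<eta> \<omega>1 \<omega>2 \<theta> p'
      (R_op N \<eta> \<omega>1 \<omega>2 \<theta> i (tile_arg \<omega>1 (p ! (i - 1))) \<otimes>\<^bsub>dq N \<eta> \<omega>1 \<omega>2 \<theta>\<^esub> v)"
| half_tile: "basis_rel N \<eta> \<omega>1 \<omega>2 \<theta> p v \<Longrightarrow> adds_half_tile N p p' \<Longrightarrow>
    basis_rel N \<eta> \<omega>1 \<omega>2 \<theta> p'
      (K_op N \<eta> \<omega>1 \<omega>2 \<theta> (tile_arg \<omega>1 (p ! (N - 1))) \<otimes>\<^bsub>dq N \<eta> \<omega>1 \<omega>2 \<theta>\<^esub> v)"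

definition basis_vec ::
  "nat \<Rightarrow> complex \<Rightarrow> complex \<Rightarrow> complex \<Rightarrow> complex \<Rightarrow> int list \<Rightarrow> ncpoly set set" where
  "basis_vec N \<eta> \<omega>1 \<omega>2 \<theta> p = (THE v. basis_rel N \<eta> \<omega>1 \<omega>2 \<theta> p v)"

text \<open>\<open>has_matrix \<dots> x v w a b c d\<close>: left multiplication by \<open>x\<close> has on \<open>(v, w)\<close> the matrix with
  rows \<open>(a, b)\<close> and \<open>(c, d)\<close>, whose columns give the images of \<open>v\<close> and of \<open>w\<close>.\<close>

definition has_matrix ::
  "nat \<Rightarrow> complex \<Rightarrow> complex \<Rightarrow> complex \<Rightarrow> complex \<Rightarrow>
   ncpoly set set \<Rightarrow> ncpoly set set \<Rightarrow> ncpoly set set \<Rightarrow>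
   complex \<Rightarrow> complex \<Rightarrow> complex \<Rightarrow> complex \<Rightarrow> bool" where
  "has_matrix N \<eta> \<omega>1 \<omega>2 \<theta> x v w a b c d \<longleftrightarrow>
     x \<otimes>\<^bsub>dq N \<eta> \<omega>1 \<omega>2 \<theta>\<^esub> v =
       dq_scale N \<eta> \<omega>1 \<omega>2 \<theta> a v \<oplus>\<^bsub>dq N \<eta> \<omega>1 \<omega>2 \<theta>\<^esub> dq_scale N \<eta> \<omega>1 \<omega>2 \<theta> c w \<and>
     x \<otimes>\<^bsub>dq N \<eta> \<omega>1 \<omega>2 \<theta>\<^esub> w =
       dq_scale N \<eta> \<omega>1 \<omega>2 \<theta> b v \<oplus>\<^bsub>dq N \<eta> \<omega>1 \<omega>2 \<theta>\<^esub> dq_scale N \<eta> \<omega>1 \<omega>2 \<theta> d w"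


section \<open>The free algebra and the quotients are rings\<close>

lemma carrier_free:
  "f \<in> carrier (free_algebra N) \<longleftrightarrow> (\<forall>w\<in>Poly_Mapping.keys f. set (letters w) \<subseteq> {..N})"
  by (simp add: free_algebra_def)

lemma free_simps [simp]:
  "mult (free_algebra N) = (*)" "one (free_algebra N) = 1"
  "zero (free_algebra N) = 0" "add (free_algebra N) = (+)"
  by (simp_all add: free_algebra_def)

lemma free_closed:
  assumes "f \<in> carrier (free_algebra N)" "g \<in> carrier (free_algebra N)"
  shows "f + g \<in> carrier (free_algebra N)" "f - g \<in> carrier (free_algebra N)"
    "f * g \<in> carrier (free_algebra N)" "- f \<in> carrier (free_algebra N)"
proof -
  show "f + g \<in> carrier (free_algebra N)" "f - g \<in> carrier (free_algebra N)"
       "- f \<in> carrier (free_algebra N)"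
    using assms keys_add[of f g] keys_diff[of f g] unfolding carrier_free by auto
  show "f * g \<in> carrier (free_algebra N)"
    unfolding carrier_free
  proof
    fix w assume "w \<in> Poly_Mapping.keys (f * g)"
    then obtain a b where "a \<in> Poly_Mapping.keys f" "b \<in> Poly_Mapping.keys g" "w = a + b"
      using keys_mult[of f g] by blast
    then show "set (letters w) \<subseteq> {..N}"
      using assms unfolding carrier_free by (auto simp: plus_word_def)
  qed
qed

lemma free_base_closed:
  "0 \<in> carrier (free_algebra N)" "1 \<in> carrier (free_algebra N)"
  "fconst c \<in> carrier (free_algebra N)" "i \<le> N \<Longrightarrow> fgen i \<in> carrier (free_algebra N)"
  by (auto simp: carrier_free fconst_def fgen_def zero_word_def)

lemma ring_free: "ring (free_algebra N)"
proof (rule ringI)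
  show "abelian_group (free_algebra N)"
  proof (rule abelian_groupI)
    fix x assume "x \<in> carrier (free_algebra N)"
    then show "\<exists>y\<in>carrier (free_algebra N). y \<oplus>\<^bsub>free_algebra N\<^esub> x = \<zero>\<^bsub>free_algebra N\<^esub>"
      by (intro bexI[of _ "- x"]) (auto simp: free_closed)
  qed (auto simp: free_closed free_base_closed algebra_simps)
  show "Group.monoid (free_algebra N)"
    by (rule monoidI) (auto simp: free_closed free_base_closed algebra_simps)
qed (auto simp: algebra_simps)

lemma tbtl_relations_closed: 
  assumes "N \<ge> 1"
  shows "tbtl_relations N \<eta> \<omega>1 \<omega>2 \<subseteq> carrier (free_algebra N)"
  using assms unfolding tbtl_relations_def by (auto intro!: free_closed free_base_closed)

lemma prod_fgen_closed:
  assumes "set is \<subseteq> {..N}"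
  shows "prod_list (map fgen is) \<in> carrier (free_algebra N)"
  using assms by (induction "is") (auto intro!: free_closed free_base_closed)

lemma I_words_closed: "I1_word N \<in> carrier (free_algebra N)" "I2_word N \<in> carrier (free_algebra N)"
  unfolding I1_word_def I2_word_def by (rule prod_fgen_closed; auto)+

lemma quot_eq:
  assumes "ring R" "S \<subseteq> carrier R" "x \<in> carrier R" "y \<in> carrier R" "x \<ominus>\<^bsub>R\<^esub> y \<in> S"
  shows "genideal R S +>\<^bsub>R\<^esub> x = genideal R S +>\<^bsub>R\<^esub> y"
proof -
  interpret R: ring R by fact
  have i: "ideal (genideal R S) R" using assms by (intro R.genideal_ideal)
  have "x \<ominus>\<^bsub>R\<^esub> y \<in> genideal R S" using R.genideal_self[OF assms(2)] assms(5) by blast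
  then show ?thesis using R.quotient_eq_iff_same_a_r_cos[OF i assms(3,4)] by simp
qed

context
  fixes N :: nat and \<eta> \<omega>1 \<omega>2 \<theta> :: complex
  assumes N: "N \<ge> 1"
begin

private abbreviation (input) "F \<equiv> free_algebra N"
private abbreviation (input) "T \<equiv> tbtl N \<eta> \<omega>1 \<omega>2"
private abbreviation (input) "A \<equiv> dq N \<eta> \<omega>1 \<omega>2 \<theta>"
private abbreviation (input) "cl \<equiv> dq_class N \<eta> \<omega>1 \<omega>2 \<theta>"
private abbreviation (input) "g \<equiv> dq_gen N \<eta> \<omega>1 \<omega>2 \<theta>"
private abbreviation (input) "cst \<equiv> dq_const N \<eta> \<omega>1 \<omega>2 \<theta>"

lemma tbtl_ideal: "ideal (tbtl_ideal N \<eta> \<omega>1 \<omega>2) F"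
  unfolding tbtl_ideal_def by (intro ring.genideal_ideal ring_free tbtl_relations_closed N)

lemma ring_tbtl: "ring T"
  unfolding tbtl_def by (rule ideal.quotient_is_ring[OF tbtl_ideal])

lemma tbtl_class_hom: "tbtl_class N \<eta> \<omega>1 \<omega>2 \<in> ring_hom F T"
  using ideal.rcos_ring_hom[OF tbtl_ideal] unfolding tbtl_def tbtl_class_def[abs_def] .

lemma dq_relations_closed: "dq_relations N \<eta> \<omega>1 \<omega>2 \<theta> \<subseteq> carrier T"
  unfolding dq_relations_def Let_def
  by (auto intro!: ring_hom_closed[OF tbtl_class_hom] free_closed free_base_closed I_words_closed)

lemma dq_ideal: "ideal (dq_ideal N \<eta> \<omega>1 \<omega>2 \<theta>) T"
  unfolding dq_ideal_def by (intro ring.genideal_ideal ring_tbtl dq_relations_closed)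

lemma ring_dq: "ring A"
  unfolding dq_def by (rule ideal.quotient_is_ring[OF dq_ideal])

lemma dq_class_hom: "cl \<in> ring_hom F A"
proof -
  have "(+>\<^bsub>T\<^esub>) (dq_ideal N \<eta> \<omega>1 \<omega>2 \<theta>) \<in> ring_hom T A"
    unfolding dq_def by (rule ideal.rcos_ring_hom[OF dq_ideal])
  from ring_hom_trans[OF tbtl_class_hom this] show ?thesis
    by (simp add: o_def dq_class_def[abs_def])
qed

lemma dq_class_eqI_tbtl:
  assumes "f \<in> carrier F" "h \<in> carrier F" "f - h \<in> tbtl_relations N \<eta> \<omega>1 \<omega>2"
  shows "cl f = cl h"
proof -
  have "f \<ominus>\<^bsub>F\<^esub> h = f - h"
  proof -
    interpret ring F by (rule ring_free)
    have "\<ominus>\<^bsub>F\<^esub> h = - h"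
      by (rule minus_equality) (use assms free_closed in auto)
    then show ?thesis by (simp add: a_minus_def)
  qed
  then have "tbtl_class N \<eta> \<omega>1 \<omega>2 f = tbtl_class N \<eta> \<omega>1 \<omega>2 h"
    unfolding tbtl_class_def tbtl_ideal_def
    by (intro quot_eq ring_free tbtl_relations_closed N assms) (use assms in simp)
  then show ?thesis by (simp add: dq_class_def)
qed

lemma dq_closed: "i \<le> N \<Longrightarrow> g i \<in> carrier A" "cst c \<in> carrier A"
  unfolding dq_gen_def dq_const_def
  by (auto intro!: ring_hom_closed[OF dq_class_hom] free_base_closed)

lemma dq_gen_commute:
  assumes "i \<le> N" "j \<le> N" "i + 1 < j \<or> j + 1 < i"
  shows "g i \<otimes>\<^bsub>A\<^esub> g j = g j \<otimes>\<^bsub>A\<^esub> g i"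
proof -
  have "cl (fgen i * fgen j) = cl (fgen j * fgen i)"
    using assms
    by (intro dq_class_eqI_tbtl free_closed free_base_closed) (auto simp: tbtl_relations_def)
  then show ?thesis
    using assms ring_hom_mult[OF dq_class_hom, of "fgen i" "fgen j"]
      ring_hom_mult[OF dq_class_hom, of "fgen j" "fgen i"]
    by (simp add: dq_gen_def free_base_closed)
qed

lemma fconst_commute: "fconst c * f = f * fconst c"
proof (induction f rule: update_induct)
  case (update f a b)
  have "Poly_Mapping.update a b f = f + Poly_Mapping.single a b"
    using update.hyps
    by (intro poly_mapping_eqI)
       (auto simp: lookup_add lookup_update lookup_single in_keys_iff when_def)
  moreover have "fconst c * Poly_Mapping.single a b = Poly_Mapping.single a b * fconst c"
    by (simp add: fconst_def mult_single mult.commute)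
  ultimately show ?case using update by (simp add: algebra_simps)
qed simp

lemma dq_const_central:
  assumes "x \<in> carrier A"
  shows "cst c \<otimes>\<^bsub>A\<^esub> x = x \<otimes>\<^bsub>A\<^esub> cst c"
proof -
  obtain t where t: "t \<in> carrier T" "x = dq_ideal N \<eta> \<omega>1 \<omega>2 \<theta> +>\<^bsub>T\<^esub> t"
    using assms unfolding dq_def FactRing_def A_RCOSETS_def' a_r_coset_def r_coset_def by auto
  obtain f where f: "f \<in> carrier F" "t = tbtl_class N \<eta> \<omega>1 \<omega>2 f"
    using t(1) unfolding tbtl_def FactRing_def A_RCOSETS_def' tbtl_class_def a_r_coset_def r_coset_def
    by auto
  have x: "x = cl f" using t f by (simp add: dq_class_def)
  show ?thesis
    using ring_hom_mult[OF dq_class_hom, of "fconst c" f]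
      ring_hom_mult[OF dq_class_hom, of f "fconst c"] f fconst_commute[of c f]
    by (simp add: x dq_const_def free_base_closed)
qed

lemma idem_closed: "i \<le> Suc N \<Longrightarrow> idem N \<eta> \<omega>1 \<omega>2 \<theta> i \<in> carrier A"
proof (induction i)
  interpret A: ring A by (rule ring_dq)
  case 0
  show ?case by simp
next
  interpret A: ring A by (rule ring_dq)
  case (Suc i)
  then show ?case by (auto simp: dq_scale_def intro!: dq_closed A.m_closed)
qed

private definition op :: "nat \<Rightarrow> complex \<Rightarrow> ncpoly set set" where
  "op i u = (if i < N then R_op N \<eta> \<omega>1 \<omega>2 \<theta> i u else K_op N \<eta> \<omega>1 \<omega>2 \<theta> u)"

private lemma op_eq:
  assumes "i \<le> N"
  obtains c where "op i u = g i \<ominus>\<^bsub>A\<^esub> cst c"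
  using assms unfolding op_def R_op_def K_op_def by (cases "i < N") auto

private lemma op_closed: "i \<le> N \<Longrightarrow> op i u \<in> carrier A"
proof -
  interpret A: ring A by (rule ring_dq)
  assume i: "i \<le> N"
  obtain c where "op i u = g i \<ominus>\<^bsub>A\<^esub> cst c" by (rule op_eq[OF i])
  then show ?thesis using i by (simp add: dq_closed)
qed

private lemma op_commute:
  assumes "i \<le> N" "j \<le> N" "i + 1 < j \<or> j + 1 < i"
  shows "op i u \<otimes>\<^bsub>A\<^esub> op j v = op j v \<otimes>\<^bsub>A\<^esub> op i u"
proof -
  interpret A: ring A by (rule ring_dq)
  obtain c where c: "op i u = g i \<ominus>\<^bsub>A\<^esub> cst c" by (rule op_eq[OF assms(1)])
  obtain d where d: "op j v = g j \<ominus>\<^bsub>A\<^esub> cst d" by (rule op_eq[OF assms(2)])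
  have *: "(x \<ominus>\<^bsub>A\<^esub> y) \<otimes>\<^bsub>A\<^esub> z = z \<otimes>\<^bsub>A\<^esub> (x \<ominus>\<^bsub>A\<^esub> y)"
    if "x \<in> carrier A" "y \<in> carrier A" "z \<in> carrier A"
      "x \<otimes>\<^bsub>A\<^esub> z = z \<otimes>\<^bsub>A\<^esub> x" "y \<otimes>\<^bsub>A\<^esub> z = z \<otimes>\<^bsub>A\<^esub> y" for x y z
    unfolding a_minus_def using that(1-3)
    by (simp add: A.l_distr A.r_distr A.l_minus A.r_minus that(4,5))
  have g: "g i \<in> carrier A" "g j \<in> carrier A" using assms by (simp_all add: dq_closed)
  have cst: "cst a \<in> carrier A" for a by (rule dq_closed)
  have 1: "(g j \<ominus>\<^bsub>A\<^esub> cst d) \<otimes>\<^bsub>A\<^esub> g i = g i \<otimes>\<^bsub>A\<^esub> (g j \<ominus>\<^bsub>A\<^esub> cst d)"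
    by (rule *[OF g(2) cst g(1)])
       (use assms dq_gen_commute[OF assms(2,1)] dq_const_central[OF g(1)] in blast)+
  show ?thesis
    unfolding c d
    by (rule *[OF g(1) cst A.minus_closed[OF g(2) cst] 1[symmetric]])
       (rule dq_const_central[OF A.minus_closed[OF g(2) cst]])
qed

private definition step where
  "step i p p' \<longleftrightarrow> is_path N p \<and> is_path N p' \<and> 1 \<le> i \<and> i \<le> N \<and>
     (\<forall>j\<le>N. j \<noteq> i \<longrightarrow> p' ! j = p ! j) \<and> (i < N \<longrightarrow> p ! (i - 1) = p ! (i + 1)) \<and>
     flips (p ! (i - 1)) (p ! i) (p' ! i)"

private definition top where
  "top i p \<longleftrightarrow> is_path N p \<and> 1 \<le> i \<and> i \<le> N \<and> (i < N \<longrightarrow> p ! (i - 1) = p ! (i + 1)) \<and>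
     (p ! (i - 1) \<ge> 0 \<and> p ! i = p ! (i - 1) + 1 \<or> p ! (i - 1) < 0 \<and> p ! i = p ! (i - 1) - 1)"

private definition drp :: "nat \<Rightarrow> int list \<Rightarrow> int list" where
  "drp i p = p[i := 2 * p ! (i - 1) - p ! i]"

private lemma step_iff:
  "step i p p' \<longleftrightarrow> adds_tile N i p p' \<or> i = N \<and> adds_half_tile N p p'"
  unfolding step_def adds_tile_def adds_half_tile_def using N by (cases "i = N") auto

private lemma drp_nth: "is_path N p \<Longrightarrow> j \<le> N \<Longrightarrow>
    drp i p ! j = (if i = j then 2 * p ! (i - 1) - p ! i else p ! j)"
  by (auto simp: drp_def is_path_def nth_list_update)

private lemma step_drp:
  assumes "top i p"
  shows "step i (drp i p) p"
proof -
  have p: "is_path N p" and i: "1 \<le> i" "i \<le> N" "i < N \<longrightarrow> p ! (i - 1) = p ! (i + 1)"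
    and d: "p ! i - p ! (i - 1) = 1 \<or> p ! i - p ! (i - 1) = - 1"
    using assms unfolding top_def by auto
  have "is_path N (drp i p)"
    unfolding is_path_def
  proof (intro conjI allI impI)
    show "length (drp i p) = Suc N" "drp i p ! 0 = 0"
      using p i by (auto simp: drp_def is_path_def)
    fix j assume j: "j < N"
    then have e: "p ! Suc j - p ! j = 1 \<or> p ! Suc j - p ! j = - 1" using p by (auto simp: is_path_def)
    have n: "drp i p ! Suc j = (if i = Suc j then 2 * p ! (i - 1) - p ! i else p ! Suc j)"
      "drp i p ! j = (if i = j then 2 * p ! (i - 1) - p ! i else p ! j)"
      by (rule drp_nth[OF p]; use j in simp)+
    consider "i = j" | "i = Suc j" | "i \<noteq> j" "i \<noteq> Suc j" by blast
    then show "drp i p ! Suc j - drp i p ! j = 1 \<or> drp i p ! Suc j - drp i p ! j = - 1"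
    proof cases
      case 1
      have "p ! (i - 1) = p ! Suc j" using i(3) j 1 by simp
      then show ?thesis unfolding n using d 1 by auto
    next
      case 2
      then show ?thesis unfolding n using d by auto
    next
      case 3
      then show ?thesis using e unfolding n by simp
    qed
  qed
  moreover have "drp i p ! j = p ! j" if "j \<le> N" "j \<noteq> i" for j
    using that by (simp add: drp_nth[OF p])
  moreover have "drp i p ! (i - 1) = p ! (i - 1)" "drp i p ! i = 2 * p ! (i - 1) - p ! i"
    using i(1,2) by (simp_all add: drp_nth[OF p])
  moreover have "drp i p ! (i + 1) = p ! (i + 1)" if "i < N"
    using that by (simp add: drp_nth[OF p])
  moreover have "flips (p ! (i - 1)) (2 * p ! (i - 1) - p ! i) (p ! i)"
    using assms unfolding top_def flips_def by arith
  ultimately show ?thesis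
    using p i unfolding step_def by simp
qed

private lemma step_top:
  assumes "step i p p'"
  shows "top i p'" "p = drp i p'"
proof -
  have i: "1 \<le> i" "i \<le> N" and p: "is_path N p" "is_path N p'"
    and eq: "\<And>j. j \<le> N \<Longrightarrow> j \<noteq> i \<Longrightarrow> p' ! j = p ! j"
    using assms unfolding step_def by auto
  have f: "flips (p ! (i - 1)) (p ! i) (p' ! i)" and n: "i < N \<longrightarrow> p ! (i - 1) = p ! (i + 1)"
    using assms unfolding step_def by blast+
  have l: "p' ! (i - 1) = p ! (i - 1)" using eq[of "i - 1"] i by simp
  have r: "p' ! (i + 1) = p ! (i + 1)" if "i < N" using eq[of "i + 1"] that by simp
  show "top i p'"
    unfolding top_def l using p(2) i n r f unfolding flips_def by (simp, blast)
  show "p = drp i p'"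
  proof (rule nth_equalityI)
    show "length p = length (drp i p')" using p by (simp add: drp_def is_path_def)
    fix j assume "j < length p"
    then have j: "j \<le> N" using p by (simp add: is_path_def)
    have "2 * p ! (i - 1) - p' ! i = p ! i" using f unfolding flips_def by arith
    then show "p ! j = drp i p' ! j"
      unfolding drp_nth[OF p(2) j] l using eq[OF j] by auto
  qed
qed

private definition wt :: "int list \<Rightarrow> nat" where
  "wt p = (\<Sum>j\<le>N. nat \<bar>2 * p ! j + 1\<bar>)"

private lemma step_wt:
  assumes "step i p p'"
  shows "wt p < wt p'"
  unfolding wt_def
proof (rule sum_strict_mono_ex1)
  have "nat \<bar>2 * p ! i + 1\<bar> < nat \<bar>2 * p' ! i + 1\<bar>"
    using assms unfolding step_def flips_def by auto
  moreover have "p ! j = p' ! j" if "j \<le> N" "j \<noteq> i" for j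
    using assms that unfolding step_def by auto
  moreover have "i \<le> N" using assms unfolding step_def by auto
  ultimately show "\<forall>j\<in>{..N}. nat \<bar>2 * p ! j + 1\<bar> \<le> nat \<bar>2 * p' ! j + 1\<bar>"
    "\<exists>j\<in>{..N}. nat \<bar>2 * p ! j + 1\<bar> < nat \<bar>2 * p' ! j + 1\<bar>"
    by (metis atMost_iff less_imp_le order_refl)+
qed simp

private lemma fund_nth: "j \<le> N \<Longrightarrow> fund_path N ! j = (if even j then 0 else - 1)"
  by (simp add: fund_path_def del: upt_Suc)

private lemma fund_no_top: "\<not> top i (fund_path N)"
  unfolding top_def by (auto simp: fund_nth split: if_splits)

private lemma is_path_fund: "is_path N (fund_path N)"
  unfolding is_path_def by (auto simp: fund_nth) (simp_all add: fund_path_def)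

private lemma ex_top:
  assumes p: "is_path N p" and ne: "p \<noteq> fund_path N"
  shows "\<exists>i. top i p"
proof -
  define f where "f j = \<bar>2 * p ! j + 1\<bar>" for j
  have "\<exists>i\<in>{..N}. \<forall>j\<in>{..N}. f j \<le> f i"
  proof -
    have "Max (f ` {..N}) \<in> f ` {..N}" by (rule Max_in) auto
    then obtain i where "i \<in> {..N}" "f i = Max (f ` {..N})" by (metis imageE)
    then show ?thesis by (metis Max_ge finite_atMost finite_imageI imageI)
  qed
  then obtain i where i: "i \<le> N" "\<And>j. j \<le> N \<Longrightarrow> f j \<le> f i" by auto
  have st: "p ! Suc j - p ! j = 1 \<or> p ! Suc j - p ! j = - 1" if "j < N" for j
    using p that by (auto simp: is_path_def)
  have p0: "p ! 0 = 0" using p by (auto simp: is_path_def)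
  show ?thesis
  proof (cases "f i \<le> 1")
    case True
    have b: "p ! j = 0 \<or> p ! j = - 1" if "j \<le> N" for j
      using i(2)[OF that] True unfolding f_def by arith
    have "p ! j = (if even j then 0 else - 1)" if "j \<le> N" for j
      using that
    proof (induction j)
      case (Suc j)
      then show ?case using st[of j] b[of "Suc j"] by (auto split: if_splits)
    qed (simp add: p0)
    then have "p = fund_path N"
      using p is_path_fund by (intro nth_equalityI) (auto simp: is_path_def fund_nth)
    then show ?thesis using ne by simp
  next
    case False
    then have i0: "i \<noteq> 0" using p0 unfolding f_def by (intro notI) simp
    then have st1: "p ! i - p ! (i - 1) = 1 \<or> p ! i - p ! (i - 1) = - 1"
      using st[of "i - 1"] i by simp
    have l: "\<bar>2 * p ! (i - 1) + 1\<bar> \<le> \<bar>2 * p ! i + 1\<bar>"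
      using i(2)[of "i - 1"] i(1) unfolding f_def by simp
    have big: "\<bar>2 * p ! i + 1\<bar> > 1" using False unfolding f_def by simp
    have "p ! (i - 1) = p ! (i + 1)" if "i < N"
    proof -
      have "\<bar>2 * p ! (i + 1) + 1\<bar> \<le> \<bar>2 * p ! i + 1\<bar>"
        using i(2)[of "i + 1"] that unfolding f_def by simp
      moreover have "p ! (i + 1) - p ! i = 1 \<or> p ! (i + 1) - p ! i = - 1"
        using st[OF that] by simp
      ultimately show ?thesis using l big st1 by linarith
    qed
    moreover have "p ! (i - 1) \<ge> 0 \<and> p ! i = p ! (i - 1) + 1 \<or>
        p ! (i - 1) < 0 \<and> p ! i = p ! (i - 1) - 1"
      using l big st1 by linarith
    ultimately have "top i p" unfolding top_def using p i0 i(1) by simp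
    then show ?thesis ..
  qed
qed

private lemma diamond:
  assumes "top i p" "top j p" "i \<noteq> j"
  shows "i + 1 < j \<or> j + 1 < i" "top j (drp i p)" "drp j (drp i p) = drp i (drp j p)"
    "drp i p ! (j - 1) = p ! (j - 1)"
proof -
  have *: "Suc a < b" if "a < b" "top a p" "top b p" for a b
  proof (rule ccontr)
    assume "\<not> Suc a < b"
    then have "b = Suc a" using that by simp
    then show False using that unfolding top_def by auto
  qed
  show far: "i + 1 < j \<or> j + 1 < i" using *[of i j] *[of j i] assms by (cases i j rule: linorder_cases) auto
  have p: "is_path N p" and ij: "1 \<le> i" "i \<le> N" "1 \<le> j" "j \<le> N"
    using assms unfolding top_def by auto
  have q: "is_path N (drp i p)" using step_drp[OF assms(1)] unfolding step_def by simp
  show n: "drp i p ! (j - 1) = p ! (j - 1)" using far ij by (auto simp: drp_nth[OF p])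
  show "top j (drp i p)"
  proof -
    have 1: "drp i p ! j = p ! j" using far ij by (auto simp: drp_nth[OF p])
    have 2: "drp i p ! (j + 1) = p ! (j + 1)" if "j < N"
      using far ij that by (auto simp: drp_nth[OF p])
    show ?thesis unfolding top_def n 1 using assms(2) q 2 unfolding top_def by simp
  qed
  have m: "drp j p ! (i - 1) = p ! (i - 1)" "drp i p ! j = p ! j" "drp j p ! i = p ! i"
    using far ij by (auto simp: drp_nth[OF p])
  show "drp j (drp i p) = drp i (drp j p)"
    unfolding drp_def[of j "drp i p"] drp_def[of i "drp j p"] n m
    using assms(3) by (simp add: drp_def list_update_swap)
qed

private abbreviation (input) "rel \<equiv> basis_rel N \<eta> \<omega>1 \<omega>2 \<theta>"

private lemma rel_step:
  assumes "rel p v" "step i p p'"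
  shows "rel p' (op i (tile_arg \<omega>1 (p ! (i - 1))) \<otimes>\<^bsub>A\<^esub> v)"
proof (cases "i < N")
  case True
  then have "adds_tile N i p p'" using assms(2) by (auto simp: step_iff)
  from basis_rel.tile[OF assms(1) this] show ?thesis using True by (simp add: op_def)
next
  case False
  then have "i = N" "adds_half_tile N p p'"
    using assms(2) by (auto simp: step_iff adds_tile_def)
  with basis_rel.half_tile[OF assms(1) this(2)] show ?thesis by (simp add: op_def)
qed

private lemma rel_cases:
  assumes "rel p' w"
  obtains "p' = fund_path N" "w = idem N \<eta> \<omega>1 \<omega>2 \<theta> N"
  | p v i where "step i p p'" "rel p v" "w = op i (tile_arg \<omega>1 (p ! (i - 1))) \<otimes>\<^bsub>A\<^esub> v"
  using assms
proof (cases rule: basis_rel.cases)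
  case start
  then show ?thesis using that by blast
next
  case (tile p v i)
  then have "step i p p'" "i < N" using N by (auto simp: step_iff adds_tile_def)
  then show ?thesis using tile that(2)[of i p v] by (simp add: op_def)
next
  case (half_tile p v)
  then have "step N p p'" by (auto simp: step_iff)
  then show ?thesis using half_tile that(2)[of N p v] by (simp add: op_def)
qed

lemma basis_rel_closed: "rel p v \<Longrightarrow> v \<in> W_module N \<eta> \<omega>1 \<omega>2 \<theta>" "rel p v \<Longrightarrow> v \<in> carrier A"
proof -
  interpret A: ring A by (rule ring_dq)
  let ?E = "idem N \<eta> \<omega>1 \<omega>2 \<theta> N"
  have E: "?E \<in> carrier A" by (rule idem_closed) simp
  show W: "v \<in> W_module N \<eta> \<omega>1 \<omega>2 \<theta>" if "rel p v" for p v
    using that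
  proof (induction "wt p" arbitrary: p v rule: less_induct)
    case less
    from less.prems show ?case
    proof (cases rule: rel_cases)
      case 1
      then show ?thesis unfolding W_module_def using E
        by (auto intro!: exI[of _ "\<one>\<^bsub>A\<^esub>"])
    next
      case (2 p0 v0 i)
      have "v0 \<in> W_module N \<eta> \<omega>1 \<omega>2 \<theta>" using less.hyps[OF step_wt[OF 2(1)] 2(2)] .
      then obtain a where a: "a \<in> carrier A" "v0 = a \<otimes>\<^bsub>A\<^esub> ?E" unfolding W_module_def by auto
      have o: "op i u \<in> carrier A" for u using 2(1) by (auto simp: step_def intro: op_closed)
      show ?thesis unfolding W_module_def 2(3) a(2)
        using a(1) E o by (auto simp: A.m_assoc[symmetric] intro!: exI)
    qed
  qed
  show "v \<in> carrier A" if "rel p v" for p v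
    using W[OF that] E unfolding W_module_def by auto
qed

private lemma rel_ex: "is_path N p \<Longrightarrow> \<exists>v. rel p v"
proof (induction "wt p" arbitrary: p rule: less_induct)
  case less
  show ?case
  proof (cases "p = fund_path N")
    case True
    then show ?thesis using basis_rel.start by blast
  next
    case False
    then obtain i where "top i p" using ex_top less.prems by blast
    then have s: "step i (drp i p) p" by (rule step_drp)
    then have "is_path N (drp i p)" by (simp add: step_def)
    then obtain v where "rel (drp i p) v" using less.hyps[OF step_wt[OF s]] by blast
    from rel_step[OF this s] show ?thesis by blast
  qed
qed

private lemma rel_unique: "rel p v \<Longrightarrow> rel p w \<Longrightarrow> v = w"
proof (induction "wt p" arbitrary: p v w rule: less_induct)
  case less
  interpret A: ring A by (rule ring_dq)
  from less.prems(1) show ?case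
  proof (cases rule: rel_cases)
    case 1
    from less.prems(2) show ?thesis
    proof (cases rule: rel_cases)
      case (2 p2 v2 j)
      then show ?thesis using step_top(1)[OF 2(1)] fund_no_top 1 by simp
    qed (use 1 in simp)
  next
    case (2 p1 v1 i)
    note s1 = this
    from less.prems(2) show ?thesis
    proof (cases rule: rel_cases)
      case 1
      then show ?thesis using step_top(1)[OF s1(1)] fund_no_top by simp
    next
      case (2 p2 v2 j)
      note s2 = this
      have t: "top i p" "top j p" and d: "p1 = drp i p" "p2 = drp j p"
        using step_top[OF s1(1)] step_top[OF s2(1)] by auto
      have IH1: "rel p1 a \<Longrightarrow> v1 = a" for a using less.hyps[OF step_wt[OF s1(1)] s1(2)] .
      have IH2: "rel p2 a \<Longrightarrow> v2 = a" for a using less.hyps[OF step_wt[OF s2(1)] s2(2)] .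
      show ?thesis
      proof (cases "i = j")
        case True
        then have "p1 = p2" using d by simp
        then have "v1 = v2" using IH1[of v2] s2(2) by blast
        then show ?thesis unfolding s1(3) s2(3) using True \<open>p1 = p2\<close> by simp
      next
        case False
        note D1 = diamond[OF t False] and D2 = diamond[OF t(2,1) False[symmetric]]
        define q where "q = drp j (drp i p)"
        have q1: "step j q p1" using step_drp[OF D1(2)] by (simp add: q_def d)
        have q2: "step i q p2" using step_drp[OF D2(2)] by (simp add: q_def d D1(3))
        have "is_path N q" using q1 by (simp add: step_def)
        then obtain u where u: "rel q u" using rel_ex by blast
        have e: "q ! (j - 1) = p2 ! (j - 1)" "q ! (i - 1) = p1 ! (i - 1)"
        proof -
          have p1: "p1 ! (j - 1) = p ! (j - 1)" "p2 ! (i - 1) = p ! (i - 1)"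
            using D1(4) D2(4) d by auto
          have j: "j - 1 \<le> N" "j - 1 \<noteq> j" "i - 1 \<le> N" "i - 1 \<noteq> i"
            using t unfolding top_def by linarith+
          have a1: "p1 ! (j - 1) = q ! (j - 1)" using q1 j by (metis step_def)
          have a2: "p2 ! (i - 1) = q ! (i - 1)" using q2 j by (metis step_def)
          have a3: "p2 ! (j - 1) = p ! (j - 1)" using s2(1) j by (metis step_def)
          have a4: "p1 ! (i - 1) = p ! (i - 1)" using s1(1) j by (metis step_def)
          show "q ! (j - 1) = p2 ! (j - 1)" "q ! (i - 1) = p1 ! (i - 1)"
            using p1 a1 a2 a3 a4 by simp_all
        qed
        let ?X = "op i (tile_arg \<omega>1 (p1 ! (i - 1)))" and ?Y = "op j (tile_arg \<omega>1 (p2 ! (j - 1)))"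
        have v1: "v1 = ?Y \<otimes>\<^bsub>A\<^esub> u" using IH1[OF rel_step[OF u q1]] e by simp
        have v2: "v2 = ?X \<otimes>\<^bsub>A\<^esub> u" using IH2[OF rel_step[OF u q2]] e by simp
        have N': "i \<le> N" "j \<le> N" using t unfolding top_def by blast+
        have c: "?X \<in> carrier A" "?Y \<in> carrier A" "u \<in> carrier A"
          by (rule op_closed N' basis_rel_closed(2)[OF u])+
        have "?X \<otimes>\<^bsub>A\<^esub> (?Y \<otimes>\<^bsub>A\<^esub> u) = ?Y \<otimes>\<^bsub>A\<^esub> (?X \<otimes>\<^bsub>A\<^esub> u)"
          using op_commute[OF N' D1(1)] c by (simp add: A.m_assoc[symmetric])
        then show ?thesis unfolding s1(3) s2(3) v1 v2 .
      qed
    qed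
  qed
qed

lemma basis_rel_ex1: "is_path N p \<Longrightarrow> \<exists>!v. basis_rel N \<eta> \<omega>1 \<omega>2 \<theta> p v"
  using rel_ex rel_unique by blast

private lemma basis_rel_vec: "is_path N p \<Longrightarrow> rel p (basis_vec N \<eta> \<omega>1 \<omega>2 \<theta> p)"
  unfolding basis_vec_def by (rule theI') (rule basis_rel_ex1)

lemma basis_vec_in_W: "is_path N p \<Longrightarrow> basis_vec N \<eta> \<omega>1 \<omega>2 \<theta> p \<in> W_module N \<eta> \<omega>1 \<omega>2 \<theta>"
  by (rule basis_rel_closed(1)[OF basis_rel_vec])

lemma basis_vec_fund: "basis_vec N \<eta> \<omega>1 \<omega>2 \<theta> (fund_path N) = idem N \<eta> \<omega>1 \<omega>2 \<theta> N"
  using rel_unique[OF basis_rel_vec[OF is_path_fund] basis_rel.start] .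

lemma basis_vec_tile:
  assumes "adds_tile N i p p'"
  shows "basis_vec N \<eta> \<omega>1 \<omega>2 \<theta> p' =
    R_op N \<eta> \<omega>1 \<omega>2 \<theta> i (tile_arg \<omega>1 (p ! (i - 1))) \<otimes>\<^bsub>A\<^esub> basis_vec N \<eta> \<omega>1 \<omega>2 \<theta> p"
proof -
  have "is_path N p" "is_path N p'" using assms by (auto simp: adds_tile_def)
  then show ?thesis
    by (intro rel_unique[OF basis_rel_vec basis_rel.tile[OF basis_rel_vec assms]])
qed

lemma basis_vec_half_tile:
  assumes "adds_half_tile N p p'"
  shows "basis_vec N \<eta> \<omega>1 \<omega>2 \<theta> p' =
    K_op N \<eta> \<omega>1 \<omega>2 \<theta> (tile_arg \<omega>1 (p ! (N - 1))) \<otimes>\<^bsub>A\<^esub> basis_vec N \<eta> \<omega>1 \<omega>2 \<theta> p"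
proof -
  have "is_path N p" "is_path N p'" using assms by (auto simp: adds_half_tile_def)
  then show ?thesis
    by (intro rel_unique[OF basis_rel_vec basis_rel.half_tile[OF basis_rel_vec assms]])
qed

end

end

theory Submission
  imports Defs
begin

text \<open>
  The two matrices only use that \<open>e\<^sub>i\<close> satisfies a quadratic relation whose coefficient splits as
  \<open>r(u) + r(-u)\<close>, respectively \<open>k(u) + k(-u)\<close>. The content is that \<open>e\<^sub>i\<close> kills slopes. For this,
  consider the last addition leading to a path with a slope at \<open>i\<close>. If it is far from \<open>i\<close>, it
  commutes with \<open>e\<^sub>i\<close>. If it is at \<open>j = i \<plusminus> 1\<close>, then either it was preceded by an addition at \<open>i\<close>,
  and the Yang--Baxter or reflection equation reduces the claim to a smaller path, or the path
  was fundamental around \<open>i\<close> and \<open>j\<close>, and the claim reduces to \<open>e\<^sub>i e\<^sub>j E\<^sub>N = c e\<^sub>i E\<^sub>N\<close> with \<open>c\<close> equal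
  to the scalar subtracted in the addition. The latter holds because \<open>E\<^sub>N\<close> factors as
  \<open>M\<^sub>1 M\<^sub>2 \<cdots> M\<^sub>N z\<close>, where \<open>M\<^sub>k = e\<^sub>k\<^sub>-\<^sub>1 e\<^sub>k\<^sub>-\<^sub>3 \<cdots>\<close> are layers of commuting generators with
  \<open>M\<^sub>k\<^sub>+\<^sub>1 M\<^sub>k M\<^sub>k\<^sub>+\<^sub>1\<close> a multiple of \<open>M\<^sub>k\<^sub>+\<^sub>1\<close>; the case \<open>j = N\<close> uses the relation between \<open>I\<^sub>1\<close> and \<open>I\<^sub>2\<close>, which
  are \<open>M\<^sub>N\<close> and \<open>M\<^sub>N\<^sub>+\<^sub>1\<close> up to order.
\<close>

section \<open>Scalar identities\<close>

text \<open>Twice the hyperbolic cosine of \<eta> x. Products of q-numbers are differences of its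
  values, so the identities for \<open>k_fun\<close> become linear in them.\<close>

definition qcosh :: "complex \<Rightarrow> complex \<Rightarrow> complex" where
  "qcosh \<eta> x = exp (\<eta> * x) + exp (- (\<eta> * x))"

lemma qcosh_minus: "qcosh \<eta> (- x) = qcosh \<eta> x"
  by (simp add: qcosh_def)

lemma qcosh_cong: "x = y \<or> x = - y \<Longrightarrow> qcosh \<eta> x = qcosh \<eta> y"
  using qcosh_minus by auto

lemma qnum_minus: "qnum \<eta> (- x) = - qnum \<eta> x"
  by (simp add: qnum_def divide_simps)

lemma qnum_mult:
  "qnum \<eta> x * qnum \<eta> y = (qcosh \<eta> (x + y) - qcosh \<eta> (x - y)) / (exp \<eta> - exp (- \<eta>))\<^sup>2"
proof -
  have "(exp (\<eta> * x) - exp (- (\<eta> * x))) * (exp (\<eta> * y) - exp (- (\<eta> * y))) =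
      qcosh \<eta> (x + y) - qcosh \<eta> (x - y)"
    by (simp add: qcosh_def algebra_simps flip: exp_add)
  then show ?thesis by (simp add: qnum_def power2_eq_square)
qed

lemma qnum_2:
  assumes "exp \<eta> - exp (- \<eta>) \<noteq> 0"
  shows "qnum \<eta> (x + 1) + qnum \<eta> (x - 1) = qnum \<eta> 2 * qnum \<eta> x"
proof -
  have "qnum \<eta> 2 = (exp \<eta> + exp (- \<eta>))"
  proof -
    have "exp (\<eta> * 2) - exp (- (\<eta> * 2)) = (exp \<eta> + exp (- \<eta>)) * (exp \<eta> - exp (- \<eta>))"
      by (simp add: algebra_simps flip: exp_add)
    then show ?thesis using assms by (simp add: qnum_def)
  qed
  then show ?thesis
    by (simp add: qnum_def algebra_simps add_divide_distrib diff_divide_distrib flip: exp_add)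
qed

section \<open>Splittings of the weights, and the scalar Yang--Baxter and reflection
  identities\<close>

lemma r_fun_sum:
  assumes "exp \<eta> - exp (- \<eta>) \<noteq> 0" "qnum \<eta> u \<noteq> 0"
  shows "r_fun \<eta> u + r_fun \<eta> (- u) = qnum \<eta> 2"
proof -
  have "r_fun \<eta> (- u) = qnum \<eta> (u - 1) / qnum \<eta> u"
    using qnum_minus[of \<eta> "u - 1"] qnum_minus[of \<eta> u] by (simp add: r_fun_def)
  then show ?thesis
    using qnum_2[OF assms(1), of u] assms(2) by (simp add: r_fun_def add_divide_distrib[symmetric])
qed

text \<open>This is the scalar condition of \<open>slope_vanish\<close> for two bulk tiles, where
  \<kappa> = 0: an addition at argument u next to one at u - 1.\<close>

lemma r_fun_unitarity:
  assumes "qnum \<eta> u \<noteq> 0" "qnum \<eta> (u - 1) \<noteq> 0"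
  shows "r_fun \<eta> (u - 1) * r_fun \<eta> (- u) = 1"
  using qnum_minus[of \<eta> "u - 1"] qnum_minus[of \<eta> u] assms by (simp add: r_fun_def)

text \<open>The parameter \<theta> is isolated in a single summand of the numerator, so that it
  cancels visibly in the sums below.\<close>

lemma k_fun_alt:
  "k_fun \<eta> \<omega> \<theta> u = (qcosh \<eta> \<theta> - qcosh \<eta> (u - \<omega>)) / ((exp \<eta> - exp (- \<eta>))\<^sup>2 * qnum \<eta> u * qnum \<eta> (\<omega> + 1))"
proof -
  have "(u - \<omega> + \<theta>) / 2 + (u - \<omega> - \<theta>) / 2 = u - \<omega>" "(u - \<omega> + \<theta>) / 2 - (u - \<omega> - \<theta>) / 2 = \<theta>"
    by (simp_all add: field_simps)
  then have "qnum \<eta> ((u - \<omega> + \<theta>) / 2) * qnum \<eta> ((u - \<omega> - \<theta>) / 2) =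
      (qcosh \<eta> (u - \<omega>) - qcosh \<eta> \<theta>) / (exp \<eta> - exp (- \<eta>))\<^sup>2"
    by (simp only: qnum_mult)
  then show ?thesis
    by (simp add: k_fun_def mult.assoc minus_divide_left)
qed

text \<open>The terms with \<theta> cancel because [u] is odd; what remains is the product formula
  for [u] [\<omega>].\<close>

lemma k_fun_sum:
  assumes "exp \<eta> - exp (- \<eta>) \<noteq> 0" "qnum \<eta> u \<noteq> 0" "qnum \<eta> (\<omega> + 1) \<noteq> 0"
  shows "k_fun \<eta> \<omega> \<theta> u + k_fun \<eta> \<omega> \<theta> (- u) = loop_weight \<eta> \<omega>"
proof -
  let ?D = "(exp \<eta> - exp (- \<eta>))\<^sup>2"
  have e: "?D * (qnum \<eta> u * qnum \<eta> \<omega>) = qcosh \<eta> (u + \<omega>) - qcosh \<eta> (u - \<omega>)"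
    using assms(1) by (simp add: qnum_mult)
  have c: "qcosh \<eta> (- u - \<omega>) = qcosh \<eta> (u + \<omega>)" by (rule qcosh_cong) simp
  have "k_fun \<eta> \<omega> \<theta> u + k_fun \<eta> \<omega> \<theta> (- u) =
      (qcosh \<eta> (u + \<omega>) - qcosh \<eta> (u - \<omega>)) / (?D * qnum \<eta> u * qnum \<eta> (\<omega> + 1))"
    unfolding k_fun_alt qnum_minus c using assms by (simp add: divide_simps)
  also have "\<dots> = loop_weight \<eta> \<omega>"
    unfolding e[symmetric] loop_weight_def using assms by simp
  finally show ?thesis .
qed

text \<open>The factors [u + 1] and [u - 1] of r cancel against denominators of k. Both summands
  then share one denominator, the \<theta> terms cancel, and the product formula for [u]
  [\<omega> + 1] gives 1.\<close>

lemma reflection_identity: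
  assumes "exp \<eta> - exp (- \<eta>) \<noteq> 0" "qnum \<eta> (\<omega> + 1) \<noteq> 0"
    "qnum \<eta> u \<noteq> 0" "qnum \<eta> (u + 1) \<noteq> 0" "qnum \<eta> (u - 1) \<noteq> 0"
  shows "r_fun \<eta> u * k_fun \<eta> \<omega> \<theta> (- u - 1) + k_fun \<eta> \<omega> \<theta> (u - 1) * r_fun \<eta> (- u) = 1"
proof -
  let ?D = "(exp \<eta> - exp (- \<eta>))\<^sup>2"
  have e: "?D * (qnum \<eta> u * qnum \<eta> (\<omega> + 1)) = qcosh \<eta> (u + \<omega> + 1) - qcosh \<eta> (u - \<omega> - 1)"
    using assms(1) by (simp add: qnum_mult add.assoc diff_diff_eq)
  have m: "qnum \<eta> (- u - 1) = - qnum \<eta> (u + 1)" "qnum \<eta> (1 - u) = - qnum \<eta> (u - 1)"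
    using qnum_minus[of \<eta> "u + 1"] qnum_minus[of \<eta> "u - 1"] by simp_all
  have c: "qcosh \<eta> (- u - 1 - \<omega>) = qcosh \<eta> (u + \<omega> + 1)" "qcosh \<eta> (u - 1 - \<omega>) = qcosh \<eta> (u - \<omega> - 1)"
    by (rule qcosh_cong; simp)+
  have 1: "r_fun \<eta> u * k_fun \<eta> \<omega> \<theta> (- u - 1) =
      (qcosh \<eta> (u + \<omega> + 1) - qcosh \<eta> \<theta>) / (?D * (qnum \<eta> u * qnum \<eta> (\<omega> + 1)))"
    unfolding k_fun_alt r_fun_def m c using assms by (simp add: divide_simps)
  have 2: "k_fun \<eta> \<omega> \<theta> (u - 1) * r_fun \<eta> (- u) =
      (qcosh \<eta> \<theta> - qcosh \<eta> (u - \<omega> - 1)) / (?D * (qnum \<eta> u * qnum \<eta> (\<omega> + 1)))"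
    unfolding k_fun_alt r_fun_def m c qnum_minus[of \<eta> u] using assms m by (simp add: divide_simps)
  have "?D * (qnum \<eta> u * qnum \<eta> (\<omega> + 1)) \<noteq> 0" using assms by simp
  then show ?thesis unfolding 1 2 add_divide_distrib[symmetric] by (simp add: e)
qed

text \<open>Here - \<omega>1 - 1 is \<open>tile_arg\<close> at height -1, the height of the
  fundamental path at N - 1 when N is even.\<close>

lemma b_weight_even:
  assumes "even N"
  shows "b_weight N \<eta> \<omega>1 \<omega>2 \<theta> = k_fun \<eta> \<omega>2 \<theta> (- \<omega>1 - 1)"
proof -
  have "qnum \<eta> ((- \<omega>1 - 1 - \<omega>2 + \<theta>) / 2) = - qnum \<eta> ((\<omega>1 + \<omega>2 + 1 - \<theta>) / 2)"
    "qnum \<eta> ((- \<omega>1 - 1 - \<omega>2 - \<theta>) / 2) = - qnum \<eta> ((\<omega>1 + \<omega>2 + 1 + \<theta>) / 2)"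
    "qnum \<eta> (- \<omega>1 - 1) = - qnum \<eta> (\<omega>1 + 1)"
    unfolding qnum_minus[symmetric] by (rule arg_cong[where f = "qnum \<eta>"]; simp add: field_simps)+
  then show ?thesis using assms by (simp add: b_weight_def k_fun_def)
qed

text \<open>For odd N the fundamental path has height 0 at N - 1, with \<open>tile_arg\<close> equal
  to \<omega>1; the extra factor is \<open>sandwich_coeff (N - 1)\<close>.\<close>

lemma b_weight_odd:
  assumes "odd N" "qnum \<eta> \<omega>1 \<noteq> 0"
  shows "b_weight N \<eta> \<omega>1 \<omega>2 \<theta> = loop_weight \<eta> \<omega>1 * k_fun \<eta> \<omega>2 \<theta> \<omega>1"
proof -
  have "a / (x * c) = y / x * (a / (y * c))" if "y \<noteq> 0" for a c x y :: complex
    using that by simp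
  from this[OF assms(2)] show ?thesis
    using assms(1) by (simp add: b_weight_def k_fun_def loop_weight_def)
qed

section \<open>Layers of commuting generators\<close>

text \<open>The two-boundary relations with arbitrary weights, detached from the quotient
  construction; scalars are central ring elements. The relation between I_1 and I_2 is kept apart
  and enters as a hypothesis on layers.\<close>

locale boundary_tl = ring A for A (structure) +
  fixes N :: nat and g :: "nat \<Rightarrow> 'a" and cst :: "complex \<Rightarrow> 'a" and \<delta> s s' :: complex
  assumes N_pos: "1 \<le> N"
    and g_closed [simp]: "i \<le> N \<Longrightarrow> g i \<in> carrier A"
    and cst_closed [simp]: "cst c \<in> carrier A"
    and cst_add: "cst (a + b) = cst a \<oplus> cst b"
    and cst_mult: "cst (a * b) = cst a \<otimes> cst b"
    and cst_one: "cst 1 = \<one>"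
    and cst_central: "x \<in> carrier A \<Longrightarrow> cst c \<otimes> x = x \<otimes> cst c"
    and g_commute: "i \<le> N \<Longrightarrow> j \<le> N \<Longrightarrow> i + 1 < j \<or> j + 1 < i \<Longrightarrow> g i \<otimes> g j = g j \<otimes> g i"
    and g_neighbours: "1 \<le> i \<Longrightarrow> i < N \<Longrightarrow> j = i + 1 \<or> i = j + 1 \<Longrightarrow> g i \<otimes> g j \<otimes> g i = g i"
    and g_square: "1 \<le> i \<Longrightarrow> i < N \<Longrightarrow> g i \<otimes> g i = cst \<delta> \<otimes> g i"
    and g_square_left: "g 0 \<otimes> g 0 = cst s \<otimes> g 0"
    and g_square_right: "g N \<otimes> g N = cst s' \<otimes> g N"
begin

section \<open>Scalar multiples and the relations applied to a vector\<close>

definition sc :: "complex \<Rightarrow> 'a \<Rightarrow> 'a" where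
  "sc c x = cst c \<otimes> x"

lemma sc_closed [simp]: "x \<in> carrier A \<Longrightarrow> sc c x \<in> carrier A"
  by (simp add: sc_def)

lemma sc_sc [simp]: "x \<in> carrier A \<Longrightarrow> sc a (sc b x) = sc (a * b) x"
  by (simp add: sc_def cst_mult m_assoc)

lemma sc_one [simp]: "x \<in> carrier A \<Longrightarrow> sc 1 x = x"
  by (simp add: sc_def cst_one)

lemma sc_add: "x \<in> carrier A \<Longrightarrow> sc (a + b) x = sc a x \<oplus> sc b x"
  by (simp add: sc_def cst_add l_distr)

lemma sc_zero [simp]: "x \<in> carrier A \<Longrightarrow> sc 0 x = \<zero>"
  using sc_add[of x 0 0] by (metis add.l_cancel_one' add_0 sc_closed)

lemma sc_plus: "x \<in> carrier A \<Longrightarrow> y \<in> carrier A \<Longrightarrow> sc a (x \<oplus> y) = sc a x \<oplus> sc a y"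
  by (simp add: sc_def r_distr)

lemma sc_null [simp]: "sc a \<zero> = \<zero>"
  by (simp add: sc_def)

lemma mult_sc: "x \<in> carrier A \<Longrightarrow> y \<in> carrier A \<Longrightarrow> x \<otimes> sc c y = sc c (x \<otimes> y)"
  unfolding sc_def by (metis cst_central cst_closed m_assoc)

lemma minus_sc: "x \<in> carrier A \<Longrightarrow> y \<in> carrier A \<Longrightarrow> x \<ominus> sc c y = x \<oplus> sc (- c) y"
proof -
  assume xy: "x \<in> carrier A" "y \<in> carrier A"
  have "sc (- c) y \<oplus> sc c y = \<zero>" using xy sc_add[of y "- c" c] by simp
  then have "sc (- c) y = \<ominus> sc c y" using xy by (simp add: minus_equality)
  then show ?thesis by (simp add: a_minus_def)
qed

lemma sc_left_cancel:
  assumes "x \<in> carrier A" "y \<in> carrier A" "a \<noteq> 0" "sc a x = sc b y"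
  shows "x = sc (b / a) y"
proof -
  have "sc (1 / a) (sc a x) = x" using assms(1,3) by simp
  then show ?thesis unfolding assms(4) using assms(2) by simp
qed

lemma shifted_mult:
  assumes "i \<le> N" "x \<in> carrier A"
  shows "(g i \<ominus> cst c) \<otimes> x = g i \<otimes> x \<oplus> sc (- c) x"
  using assms minus_sc[of "g i \<otimes> x" x c]
  by (simp add: a_minus_def l_distr l_minus sc_def)

lemma g_sc: "i \<le> N \<Longrightarrow> x \<in> carrier A \<Longrightarrow> g i \<otimes> sc c x = sc c (g i \<otimes> x)"
  by (simp add: mult_sc)

lemma g_swap:
  "i \<le> N \<Longrightarrow> j \<le> N \<Longrightarrow> i + 1 < j \<or> j + 1 < i \<Longrightarrow> x \<in> carrier A \<Longrightarrow>
    g i \<otimes> (g j \<otimes> x) = g j \<otimes> (g i \<otimes> x)"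
  by (metis g_closed g_commute m_assoc)

lemma g_triple:
  assumes "1 \<le> i" "i < N" "j = i + 1 \<or> i = j + 1" "x \<in> carrier A"
  shows "g i \<otimes> (g j \<otimes> (g i \<otimes> x)) = g i \<otimes> x"
  using g_neighbours[OF assms(1-3)] assms by (auto simp flip: m_assoc)

lemma g_twice: "1 \<le> i \<Longrightarrow> i < N \<Longrightarrow> x \<in> carrier A \<Longrightarrow> g i \<otimes> (g i \<otimes> x) = sc \<delta> (g i \<otimes> x)"
  unfolding sc_def by (metis cst_closed g_closed g_square m_assoc less_imp_le)

lemma g0_twice: "x \<in> carrier A \<Longrightarrow> g 0 \<otimes> (g 0 \<otimes> x) = sc s (g 0 \<otimes> x)"
  unfolding sc_def by (metis cst_closed g_closed g_square_left m_assoc le0)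

lemma gN_twice: "x \<in> carrier A \<Longrightarrow> g N \<otimes> (g N \<otimes> x) = sc s' (g N \<otimes> x)"
  unfolding sc_def by (metis cst_closed g_closed g_square_right m_assoc order_refl)

text \<open>Layers are operators on a vector, so that relations apply inside long products without
  reassociation. \<open>layer k x\<close> is M_k x with M_0 = 1, \<open>tri k x\<close> is M_1 M_2
  ... M_k x and \<open>rtri k x\<close> is M_k ... M_2 M_1 x.\<close>

fun layer :: "nat \<Rightarrow> 'a \<Rightarrow> 'a" where
  "layer 0 x = x"
| "layer (Suc 0) x = g 0 \<otimes> x"
| "layer (Suc (Suc k)) x = layer k (g (Suc k) \<otimes> x)"

primrec tri :: "nat \<Rightarrow> 'a \<Rightarrow> 'a" where
  "tri 0 x = x"
| "tri (Suc k) x = tri k (layer (Suc k) x)"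

primrec rtri :: "nat \<Rightarrow> 'a \<Rightarrow> 'a" where
  "rtri 0 x = x"
| "rtri (Suc k) x = layer (Suc k) (rtri k x)"

section \<open>Closure, scalars and commutation for layers\<close>

lemma layer_closed [simp]: "k \<le> Suc N \<Longrightarrow> x \<in> carrier A \<Longrightarrow> layer k x \<in> carrier A"
  by (induction k x rule: layer.induct) simp_all

lemma tri_closed [simp]: "k \<le> Suc N \<Longrightarrow> x \<in> carrier A \<Longrightarrow> tri k x \<in> carrier A"
  by (induction k arbitrary: x) simp_all

lemma rtri_closed [simp]: "k \<le> Suc N \<Longrightarrow> x \<in> carrier A \<Longrightarrow> rtri k x \<in> carrier A"
  by (induction k) simp_all

lemma layer_sc: "k \<le> Suc N \<Longrightarrow> x \<in> carrier A \<Longrightarrow> layer k (sc c x) = sc c (layer k x)"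
  by (induction k x rule: layer.induct) (simp_all add: g_sc)

lemma tri_sc: "k \<le> Suc N \<Longrightarrow> x \<in> carrier A \<Longrightarrow> tri k (sc c x) = sc c (tri k x)"
  by (induction k arbitrary: x) (simp_all add: layer_sc)

lemma layer_swap:
  "k < j \<Longrightarrow> j \<le> N \<Longrightarrow> x \<in> carrier A \<Longrightarrow> layer k (g j \<otimes> x) = g j \<otimes> layer k x"
  by (induction k x rule: layer.induct) (simp_all add: g_swap)

lemma tri_swap:
  "k < j \<Longrightarrow> j \<le> N \<Longrightarrow> x \<in> carrier A \<Longrightarrow> tri k (g j \<otimes> x) = g j \<otimes> tri k x"
  by (induction k arbitrary: x) (simp_all add: layer_swap)

lemma layer_Suc_Suc:
  "k < N \<Longrightarrow> x \<in> carrier A \<Longrightarrow> layer (Suc (Suc k)) x = g (Suc k) \<otimes> layer k x"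
  by (simp add: layer_swap)

text \<open>The factor in M_{k+1} M_k M_{k+1} = c M_{k+1}. For even k the layer M_{k+1} contains
  \<open>g 0\<close>, whose square leaves the weight s; for odd k only triples e_i e_{i-1} e_i = e_i
  occur, which cost nothing.\<close>

definition sandwich_coeff :: "nat \<Rightarrow> complex" where
  "sandwich_coeff k = (if even k then s else 1)"

lemma layer_sandwich:
  "k < N \<Longrightarrow> x \<in> carrier A \<Longrightarrow>
    layer (Suc k) (layer k (layer (Suc k) x)) = sc (sandwich_coeff k) (layer (Suc k) x)"
proof (induction k arbitrary: x rule: induct_nat_012)
  case (ge2 k)
  let ?y = "layer k (layer (Suc k) x)"
  have y: "?y \<in> carrier A" using ge2.prems by simp
  have "layer (Suc (Suc k)) (layer (Suc (Suc (Suc k))) x) = g (Suc k) \<otimes> (g (Suc (Suc k)) \<otimes> ?y)"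
    using ge2.prems by (simp add: layer_Suc_Suc layer_swap del: layer.simps)
  \<comment> \<open>The triple of top generators collapses, leaving a sandwich two sizes smaller;
    hence the induction in steps of two.\<close>
  then have "layer (Suc (Suc (Suc k))) (layer (Suc (Suc k)) (layer (Suc (Suc (Suc k))) x)) =
      layer (Suc k) (g (Suc (Suc k)) \<otimes> ?y)"
    using ge2.prems y g_triple[of "Suc (Suc k)" "Suc k" ?y] by simp
  also have "\<dots> = g (Suc (Suc k)) \<otimes> layer (Suc k) ?y"
    using ge2.prems y by (simp add: layer_swap)
  also have "\<dots> = sc (sandwich_coeff k) (layer (Suc (Suc (Suc k))) x)"
    using ge2.prems by (simp add: ge2.IH(1) g_sc layer_swap)
  finally show ?case by (simp add: sandwich_coeff_def)
qed (use N_pos in \<open>auto simp: sandwich_coeff_def g0_twice g_triple\<close>)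

text \<open>The product M_k ... M_1 M_1 ... M_k collapses from the inside out by
  \<open>layer_sandwich\<close>. The constant can stay implicit, as it is later absorbed into a
  vector.\<close>

lemma rtri_tri:
  "k \<le> N \<Longrightarrow> \<exists>c. \<forall>x\<in>carrier A. rtri k (tri k x) = sc c (layer k x)"
proof (induction k)
  case 0
  show ?case by (intro exI[of _ 1]) simp
next
  case (Suc k)
  then obtain c where "\<forall>x\<in>carrier A. rtri k (tri k x) = sc c (layer k x)" by auto
  then show ?case
    using Suc.prems by (intro exI[of _ "c * sandwich_coeff k"]) (simp add: layer_sc layer_sandwich)
qed

text \<open>By induction \<open>E (Suc k)\<close> acts as a multiple of the palindrome M_1 ...
  M_{k+1} M_k ... M_1. Between two such factors the new generator passes through the lower layers,
  and the halves facing each other collapse by \<open>rtri_tri\<close>.\<close>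

lemma idem_factor:
  assumes "E 0 = \<one>" and step: "\<And>k. k < N \<Longrightarrow> E (Suc k) = sc (a k) (E k \<otimes> g k \<otimes> E k)"
  shows "\<exists>z\<in>carrier A. E N = tri N z"
proof -
  have *: "E (Suc k) \<in> carrier A \<and> (\<exists>c. \<forall>x\<in>carrier A. E (Suc k) \<otimes> x = sc c (tri (Suc k) (rtri k x)))"
    if "k < N" for k
    using that
  proof (induction k)
    case 0
    then show ?case using step[of 0] assms(1) by (auto simp: sc_def m_assoc)
  next
    case (Suc k)
    then obtain c where E: "E (Suc k) \<in> carrier A"
      and c: "\<forall>x\<in>carrier A. E (Suc k) \<otimes> x = sc c (tri (Suc k) (rtri k x))" by auto
    obtain d where d: "\<forall>x\<in>carrier A. rtri k (tri k x) = sc d (layer k x)"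
      using rtri_tri[of k] Suc.prems by auto
    have "E (Suc (Suc k)) \<otimes> x = sc (a (Suc k) * c * c * d) (tri (Suc (Suc k)) (rtri (Suc k) x))"
      if x: "x \<in> carrier A" for x
    proof -
      let ?y = "rtri (Suc k) x"
      have y: "?y \<in> carrier A" using x Suc.prems by simp
      have "E (Suc (Suc k)) \<otimes> x = sc (a (Suc k)) (E (Suc k) \<otimes> (g (Suc k) \<otimes> (E (Suc k) \<otimes> x)))"
        using step[OF Suc.prems] E x Suc.prems by (simp add: sc_def m_assoc)
      \<comment> \<open>The middle layer of the palindrome is moved from the left half to the right
        half, so that the remaining left half commutes with \<open>g (Suc k)\<close>.\<close>
      also have "E (Suc k) \<otimes> x = sc c (tri k ?y)" using c x by simp
      also have "g (Suc k) \<otimes> sc c (tri k ?y) = sc c (tri k (g (Suc k) \<otimes> ?y))"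
        using Suc.prems y by (simp add: g_sc tri_swap)
      also have "E (Suc k) \<otimes> sc c (tri k (g (Suc k) \<otimes> ?y)) =
          sc (c * c) (tri (Suc k) (rtri k (tri k (g (Suc k) \<otimes> ?y))))"
        using c Suc.prems y E by (simp add: mult_sc del: tri.simps)
      \<comment> \<open>The collapse leaves M_k, and M_k followed by \<open>g (Suc k)\<close> is the
        next layer M_{k+2}.\<close>
      also have "rtri k (tri k (g (Suc k) \<otimes> ?y)) = sc d (layer (Suc (Suc k)) ?y)"
        using d y Suc.prems by simp
      also have "tri (Suc k) (sc d (layer (Suc (Suc k)) ?y)) = sc d (tri (Suc (Suc k)) ?y)"
        using y Suc.prems by (simp add: tri_sc del: layer.simps tri.simps) simp
      finally show ?thesis
        using y Suc.prems by (simp add: mult.assoc del: layer.simps tri.simps)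
    qed
    moreover have "E (Suc (Suc k)) \<in> carrier A" using step[OF Suc.prems] E Suc.prems by simp
    ultimately show ?case by blast
  qed
  obtain n where n: "N = Suc n" using N_pos by (cases N) auto
  obtain c where E: "E N \<in> carrier A" and c: "\<forall>x\<in>carrier A. E N \<otimes> x = sc c (tri N (rtri n x))"
    using *[of n] n by auto
  have "E N = E N \<otimes> \<one>" using E by simp
  also have "\<dots> = tri N (sc c (rtri n \<one>))" using c n by (simp add: tri_sc del: tri.simps)
  finally show ?thesis using n by (intro bexI[of _ "sc c (rtri n \<one>)"]) simp_all
qed

section \<open>Generators acting on the triangle of layers\<close>

text \<open>Truncated subtraction is harmless here: \<open>layer 0\<close> and \<open>tri 0\<close> are the identity.\<close>

lemma tri_pred: "tri (i - Suc 0) x = tri (i - 2) (layer (i - Suc 0) x)"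
  by (cases "i - Suc 0") (auto simp: numeral_2_eq_2 diff_Suc split: nat.splits)

lemma layer_Suc_pred: "1 \<le> i \<Longrightarrow> layer (i - Suc 0) (g i \<otimes> x) = layer (Suc i) x"
  by (cases i) auto

text \<open>\<open>g i\<close> commutes with M_1, ..., M_{i-1}, and M_{i-1} times \<open>g i\<close>
  is M_{i+1}: the generator is absorbed by replacing the last layer.\<close>

lemma g_tri_pred:
  assumes "1 \<le> i" "i \<le> N" "x \<in> carrier A"
  shows "g i \<otimes> tri (i - 1) x = tri (i - 2) (layer (Suc i) x)"
proof -
  have "g i \<otimes> tri (i - 1) x = tri (i - 1) (g i \<otimes> x)" using assms by (simp add: tri_swap)
  then show ?thesis using assms by (simp add: tri_pred layer_Suc_pred del: layer.simps)
qed

text \<open>After the absorption the layers end in M_{i+1} M_i M_{i+1}, which is a sandwich.\<close>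

lemma g_tri:
  assumes "1 \<le> i" "i < N" "x \<in> carrier A"
  shows "g i \<otimes> tri (Suc i) x = sc (sandwich_coeff i) (tri (i - 2) (layer (Suc i) x))"
proof -
  have "tri (Suc i) x = tri (i - 1) (layer i (layer (Suc i) x))"
    using assms by (cases i) auto
  then have "g i \<otimes> tri (Suc i) x = tri (i - 2) (layer (Suc i) (layer i (layer (Suc i) x)))"
    using assms by (simp add: g_tri_pred del: One_nat_def layer.simps)
  also have "\<dots> = sc (sandwich_coeff i) (tri (i - 2) (layer (Suc i) x))"
    using assms by (simp add: layer_sandwich tri_sc)
  finally show ?thesis .
qed

text \<open>Moves the surplus layers into the vector, so that facts about a short triangle apply to
  E_N.\<close>

lemma tri_decompose: "k \<le> m \<Longrightarrow> m \<le> N \<Longrightarrow> z \<in> carrier A \<Longrightarrow> \<exists>y\<in>carrier A. tri m z = tri k y"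
proof (induction m arbitrary: z)
  case (Suc m)
  show ?case
  proof (cases "k = Suc m")
    case False
    then show ?thesis using Suc by simp
  qed (use Suc in auto)
qed auto

text \<open>Both sides are multiples of M_1 ... M_{i-2} M_{i+1} M_{i+2}. The coefficients are
  cross-multiplied because s may vanish in this locale.\<close>

lemma g_up_tri:
  assumes "1 \<le> i" "i + 1 < N" "x \<in> carrier A"
  shows "sc (sandwich_coeff i) (g i \<otimes> (g (i + 1) \<otimes> tri (Suc (Suc i)) x)) =
    sc (sandwich_coeff (i + 1)) (g i \<otimes> tri (Suc (Suc i)) x)"
proof -
  let ?y = "layer (Suc (Suc i)) x"
  have y: "?y \<in> carrier A" using assms by (simp del: layer.simps)
  have "g i \<otimes> (g (i + 1) \<otimes> tri (Suc (Suc i)) x) = sc (sandwich_coeff (i + 1)) (g i \<otimes> tri (i - 1) ?y)"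
    using assms g_tri[of "i + 1" x] y by (simp add: mult_sc del: layer.simps tri.simps)
  also have "g i \<otimes> tri (i - 1) ?y = tri (i - 2) (layer (Suc i) ?y)"
    using assms y by (intro g_tri_pred) simp_all
  finally show ?thesis
    using assms g_tri[of i ?y] y by (simp add: mult.commute del: layer.simps)
qed

lemma g_down_tri:
  assumes "2 \<le> i" "i < N" "x \<in> carrier A"
  shows "sc (sandwich_coeff i) (g i \<otimes> (g (i - 1) \<otimes> tri (Suc i) x)) =
    sc (sandwich_coeff (i - 1)) (g i \<otimes> tri (Suc i) x)"
proof -
  let ?y = "layer (Suc i) x"
  obtain k where k: "i = Suc (Suc k)" using assms(1) by (metis add_2_eq_Suc le_Suc_ex)
  have y: "?y \<in> carrier A" using assms by (simp del: layer.simps)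
  have t: "tri (Suc i) x = tri i ?y" by simp
  have "g i \<otimes> (g (i - 1) \<otimes> tri (Suc i) x) = sc (sandwich_coeff (i - 1)) (g i \<otimes> tri (k - 1) (layer i ?y))"
    unfolding t using assms g_tri[of "i - 1" ?y] y k by (simp add: mult_sc numeral_2_eq_2 del: layer.simps tri.simps)
  also have "g i \<otimes> tri (k - 1) (layer i ?y) = tri (k - 1) (layer k (layer (Suc i) x))"
  proof -
    let ?z = "layer (Suc k) x"
    have z: "?z \<in> carrier A" using assms k by simp
    \<comment> \<open>With the top generators of M_i and M_{i+1} pulled next to each other, the
      triple e_i e_{i-1} e_i appears and removes the top of M_i.\<close>
    have "g i \<otimes> layer i ?y = g i \<otimes> layer k (g (Suc k) \<otimes> (g i \<otimes> ?z))"
      using assms k by (simp add: layer_Suc_Suc[of "Suc k"] layer_swap)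
    also have "\<dots> = layer k (g i \<otimes> ?z)"
      using assms k z g_triple[of i "Suc k" ?z] by (simp add: layer_swap[symmetric])
    also have "\<dots> = layer k ?y"
      using assms k z by (simp add: layer_Suc_Suc[of "Suc k"] layer_swap)
    finally show ?thesis using assms k y by (simp add: tri_swap[symmetric] del: layer.simps)
  qed
  also have "\<dots> = tri k ?y" using k by (cases k) auto
  finally show ?thesis
    using assms g_tri[of i x] y k by (simp add: mult.commute del: layer.simps)
qed

lemma g0_tri:
  assumes "1 \<le> k" "k \<le> N" "x \<in> carrier A"
  shows "g 0 \<otimes> tri k x = sc s (tri k x)"
proof -
  obtain y where y: "y \<in> carrier A" "tri k x = tri 1 y" using tri_decompose[of 1 k x] assms by auto
  then show ?thesis by (simp add: g0_twice)
qed

text \<open>The bottom case, where the triangle begins with e_0 e_1: the triple e_1 e_0 e_1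
  collapses on one side, and the square of e_0 gives s on the other.\<close>

lemma g01_tri:
  assumes "1 < N" "x \<in> carrier A"
  shows "sc s (g 0 \<otimes> (g 1 \<otimes> tri 2 x)) = g 0 \<otimes> tri 2 x"
  using assms g_triple[of 1 0 x] by (simp add: numeral_2_eq_2 g0_twice)

text \<open>\<open>g N\<close> turns M_{N-1} into M_{N+1}, and \<open>g (N - 1)\<close> then turns
  the layer before it into M_N. The result contains M_N M_{N+1} M_N, to which the double quotient
  relation applies.\<close>

lemma g_right_tri:
  assumes "2 \<le> N" "x \<in> carrier A"
    and b: "\<And>x. x \<in> carrier A \<Longrightarrow> layer N (layer (Suc N) (layer N x)) = sc b (layer N x)"
  shows "sc (sandwich_coeff (N - 1)) (g (N - 1) \<otimes> (g N \<otimes> tri N x)) = sc b (g (N - 1) \<otimes> tri N x)"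
proof -
  obtain n where n: "N = Suc n" "1 \<le> n" using assms(1) by (cases N) auto
  let ?y = "layer N x"
  have y: "?y \<in> carrier A" "g N \<otimes> ?y \<in> carrier A" using assms by simp_all
  have "g N \<otimes> tri N x = tri (n - 1) (layer n (g N \<otimes> ?y))"
    using n y by (cases n) (simp_all add: tri_swap layer_swap del: layer.simps)
  also have "layer n (g N \<otimes> ?y) = layer (Suc N) ?y" using n by simp
  also have "g n \<otimes> tri (n - 1) (layer (Suc N) ?y) = tri (n - 2) (layer N (layer (Suc N) ?y))"
    using n y assms by (simp add: g_tri_pred del: One_nat_def layer.simps)
  also have "\<dots> = sc b (tri (n - 2) ?y)" using b[OF assms(2)] n y by (simp add: tri_sc)
  finally show ?thesis
    using n y assms g_tri[of n x] by (simp add: mult.commute del: layer.simps tri.simps)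
qed

section \<open>Consequences of the quadratic relations for shifted generators\<close>

text \<open>Covers both the Yang--Baxter move (\<open>\<kappa> = 0\<close>) and its boundary analogue.\<close>

lemma slope_vanish:
  assumes ij: "1 \<le> i" "i < N" "j \<le> N" "j = i + 1 \<or> i = j + 1" and x: "x \<in> carrier A"
    and \<kappa>: "g i \<otimes> (g j \<otimes> x) = sc \<kappa> (g i \<otimes> x)"
    and c: "1 - c * \<kappa> - c' * (\<delta> - c) = 0"
  shows "g i \<otimes> (g j \<otimes> (g i \<otimes> x \<oplus> sc (- c) x) \<oplus> sc (- c') (g i \<otimes> x \<oplus> sc (- c) x)) = \<zero>"
proof -
  let ?y = "g i \<otimes> x"
  have y: "?y \<in> carrier A" using ij x by simp
  have "g i \<otimes> (g j \<otimes> (?y \<oplus> sc (- c) x) \<oplus> sc (- c') (?y \<oplus> sc (- c) x)) =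
     (?y \<oplus> sc (- c * \<kappa>) ?y) \<oplus> (sc (- c' * \<delta>) ?y \<oplus> sc (c' * c) ?y)"
    using ij x y by (simp add: r_distr sc_plus mult_sc g_triple g_twice \<kappa>)
  also have "\<dots> = (sc 1 ?y \<oplus> sc (- c * \<kappa>) ?y) \<oplus> (sc (- c' * \<delta>) ?y \<oplus> sc (c' * c) ?y)"
    using y by simp
  also have "\<dots> = sc ((1 + - c * \<kappa>) + (- c' * \<delta> + c' * c)) ?y"
    unfolding sc_add[OF y] ..
  also have "(1 + - c * \<kappa>) + (- c' * \<delta> + c' * c) = 0" using c by (simp add: algebra_simps)
  finally show ?thesis using y by simp
qed

text \<open>The quadratic relation gives e_j (e_j - c) x = c' e_j x, and e_i does not distinguish
  e_j x from (e_j - c) x because it kills x.\<close>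

lemma shifted_eigen:
  assumes ij: "i \<le> N" "j \<le> N" and x: "x \<in> carrier A" and i: "g i \<otimes> x = \<zero>"
    and sq: "g j \<otimes> (g j \<otimes> x) = sc (c + c') (g j \<otimes> x)"
  shows "g i \<otimes> (g j \<otimes> (g j \<otimes> x \<oplus> sc (- c) x)) = sc c' (g i \<otimes> (g j \<otimes> x \<oplus> sc (- c) x))"
proof -
  let ?y = "g j \<otimes> x"
  have y: "?y \<in> carrier A" using ij x by simp
  have "g j \<otimes> (?y \<oplus> sc (- c) x) = sc ((c + c') + - c) ?y"
    unfolding sc_add[OF y, of "c + c'"] using ij x by (simp add: r_distr mult_sc sq)
  then show ?thesis using ij x y by (simp add: r_distr mult_sc i)
qed

lemma two_by_two:
  assumes "j \<le> N" "x \<in> carrier A" and sq: "g j \<otimes> (g j \<otimes> x) = sc (c + c') (g j \<otimes> x)"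
  shows "g j \<otimes> x = sc c x \<oplus> sc 1 (g j \<otimes> x \<oplus> sc (- c) x)"
    "g j \<otimes> (g j \<otimes> x \<oplus> sc (- c) x) = sc (c * c') x \<oplus> sc c' (g j \<otimes> x \<oplus> sc (- c) x)"
proof -
  let ?y = "g j \<otimes> x"
  have y: "?y \<in> carrier A" using assms by simp
  have "sc c x \<oplus> sc (- c) x = \<zero>" using sc_add[of x c "- c"] assms by simp
  then show "?y = sc c x \<oplus> sc 1 (?y \<oplus> sc (- c) x)"
    using y assms by (simp add: a_ac)
  \<comment> \<open>This zero is inserted to complete c' e_j x to c' (e_j - c) x.\<close>
  have z: "sc (c * c') x \<oplus> sc (- (c * c')) x = \<zero>"
    using sc_add[of x "c * c'" "- (c * c')"] assms by simp
  have "g j \<otimes> (?y \<oplus> sc (- c) x) = sc ((c + c') + - c) ?y"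
    unfolding sc_add[OF y, of "c + c'"] using assms by (simp add: r_distr mult_sc sq)
  also have "\<dots> = (sc (c * c') x \<oplus> sc (- (c * c')) x) \<oplus> sc c' ?y"
    unfolding z using y by simp
  also have "\<dots> = sc (c * c') x \<oplus> (sc (- (c * c')) x \<oplus> sc c' ?y)"
    using y assms by (intro a_assoc) simp_all
  also have "sc (- (c * c')) x \<oplus> sc c' ?y = sc c' (?y \<oplus> sc (- c) x)"
    using y assms by (simp add: sc_plus a_comm mult.commute)
  finally show "g j \<otimes> (?y \<oplus> sc (- c) x) = sc (c * c') x \<oplus> sc c' (?y \<oplus> sc (- c) x)" .
qed

end

section \<open>Additions of tiles\<close>

definition adds :: "nat \<Rightarrow> nat \<Rightarrow> int list \<Rightarrow> int list \<Rightarrow> bool" where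
  "adds N k q p \<longleftrightarrow> adds_tile N k q p \<or> k = N \<and> adds_half_tile N q p"

lemma adds_iff:
  assumes "1 \<le> N"
  shows "adds N k q p \<longleftrightarrow> is_path N q \<and> is_path N p \<and> 1 \<le> k \<and> k \<le> N \<and>
     (\<forall>j\<le>N. j \<noteq> k \<longrightarrow> p ! j = q ! j) \<and> (k < N \<longrightarrow> q ! (k - 1) = q ! (k + 1)) \<and>
     flips (q ! (k - 1)) (q ! k) (p ! k)"
  unfolding adds_def adds_tile_def adds_half_tile_def using assms by (cases "k = N") auto

lemma path_step: "is_path N p \<Longrightarrow> i < N \<Longrightarrow> p ! Suc i = p ! i + 1 \<or> p ! Suc i = p ! i - 1"
  unfolding is_path_def by force

lemma ex_adds:
  assumes p: "is_path N p" and i: "1 \<le> i" "i \<le> N" "i < N \<Longrightarrow> p ! (i - 1) = p ! (i + 1)"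
    and top: "p ! (i - 1) \<ge> 0 \<and> p ! i = p ! (i - 1) + 1 \<or> p ! (i - 1) < 0 \<and> p ! i = p ! (i - 1) - 1"
  obtains q where "adds N i q p"
proof -
  \<comment> \<open>Undoing the addition reflects the height at i in the height of its left
    neighbour.\<close>
  define q where "q = p[i := 2 * p ! (i - 1) - p ! i]"
  have len: "length p = Suc N" using p by (simp add: is_path_def)
  have nth: "q ! j = (if j = i then 2 * p ! (i - 1) - p ! i else p ! j)" if "j \<le> N" for j
    using that len by (auto simp: q_def nth_list_update)
  have "is_path N q"
    unfolding is_path_def
  proof (intro conjI allI impI)
    show "length q = Suc N" "q ! 0 = 0" using p i len nth[of 0] by (auto simp: q_def is_path_def)
    fix j assume j: "j < N"
    have d: "p ! i - p ! (i - 1) = 1 \<or> p ! i - p ! (i - 1) = - 1" using top by linarith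
    consider "i = j" | "i = Suc j" | "i \<noteq> j" "i \<noteq> Suc j" by blast
    then show "q ! Suc j - q ! j = 1 \<or> q ! Suc j - q ! j = - 1"
    proof cases
      case 1
      then have "q ! Suc j = p ! (i - 1)" "q ! j = 2 * p ! (i - 1) - p ! i"
        using nth[of j] nth[of "Suc j"] j i(3) by simp_all
      then show ?thesis using d by linarith
    next
      case 2
      then have "q ! Suc j = 2 * p ! (i - 1) - p ! i" "q ! j = p ! (i - 1)"
        using nth[of j] nth[of "Suc j"] j by simp_all
      then show ?thesis using d by linarith
    next
      case 3
      then have "q ! Suc j = p ! Suc j" "q ! j = p ! j" using nth[of j] nth[of "Suc j"] j by simp_all
      then show ?thesis using path_step[OF p j] by linarith
    qed
  qed
  moreover have "q ! (i - 1) = p ! (i - 1)" "q ! i = 2 * p ! (i - 1) - p ! i"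
    using i nth[of "i - 1"] nth[of i] by auto
  moreover have "i < N \<Longrightarrow> q ! (i + 1) = p ! (i + 1)" using nth[of "i + 1"] by simp
  ultimately have "adds N i q p"
    using p i top nth by (subst adds_iff) (auto simp: flips_def)
  then show thesis by (rule that)
qed

lemma fund_path_nth: "j \<le> N \<Longrightarrow> fund_path N ! j = (if even j then 0 else - 1)"
  by (simp add: fund_path_def del: upt_Suc)

text \<open>Twice the total distance of the heights from -1/2, the midline of the fundamental path;
  an addition moves one height farther away.\<close>

definition path_weight :: "nat \<Rightarrow> int list \<Rightarrow> nat" where
  "path_weight N p = (\<Sum>j\<le>N. nat \<bar>2 * p ! j + 1\<bar>)"

lemma adds_weight:
  assumes "1 \<le> N" "adds N k q p"
  shows "path_weight N q < path_weight N p"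
  unfolding path_weight_def
proof (rule sum_strict_mono_ex1)
  have k: "k \<le> N" "\<And>j. j \<le> N \<Longrightarrow> j \<noteq> k \<Longrightarrow> p ! j = q ! j" "flips (q ! (k - 1)) (q ! k) (p ! k)"
    using assms by (auto simp: adds_iff)
  then have lt: "nat \<bar>2 * q ! k + 1\<bar> < nat \<bar>2 * p ! k + 1\<bar>" by (auto simp: flips_def)
  then show "\<exists>j\<in>{..N}. nat \<bar>2 * q ! j + 1\<bar> < nat \<bar>2 * p ! j + 1\<bar>" using k(1) by blast
  show "\<forall>j\<in>{..N}. nat \<bar>2 * q ! j + 1\<bar> \<le> nat \<bar>2 * p ! j + 1\<bar>"
    using lt k(2) by (metis atMost_iff less_imp_le order_refl)
qed simp

lemma path_cases:
  assumes "1 \<le> N" "is_path N p"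
  obtains "p = fund_path N" | k q where "adds N k q p"
proof -
  \<comment> \<open>The last rule of a derivation of \<open>basis_rel\<close> exhibits the last
    addition. The shape of derivations does not depend on the parameters, so they are set to
    0.\<close>
  obtain v where "basis_rel N 0 0 0 0 p v" using basis_rel_ex1[OF assms, of 0 0 0 0] by blast
  then show thesis
    by (cases rule: basis_rel.cases) (use that in \<open>auto simp: adds_def\<close>)
qed

text \<open>The induction hypothesis covers all lighter paths, since the slope argument goes back up
  to three additions.\<close>

lemma path_induct [consumes 2, case_names fund adds]:
  assumes "1 \<le> N" "is_path N p"
    and "P (fund_path N)"
    and "\<And>p q k. adds N k q p \<Longrightarrow>
      (\<And>p'. is_path N p' \<Longrightarrow> path_weight N p' < path_weight N p \<Longrightarrow> P p') \<Longrightarrow> P p"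
  shows "P p"
  using assms(2)
proof (induction "path_weight N p" arbitrary: p rule: less_induct)
  case less
  show ?case
    using assms(1) less.prems
    by (cases rule: path_cases) (use less.hyps assms(3,4) in blast)+
qed

section \<open>The action on the basis\<close>

text \<open>\<open>layer_relation\<close> is the double quotient relation written with layers, and
  \<open>v_fund\<close> is the factorisation of E_N.\<close>

locale path_module =
  boundary_tl A N g cst "qnum \<eta> 2" "loop_weight \<eta> \<omega>1" "loop_weight \<eta> \<omega>2"
  for A (structure) and N g cst \<eta> \<omega>1 \<omega>2 +
  fixes \<theta> :: complex and v :: "int list \<Rightarrow> 'a"
  assumes N_ge_2: "2 \<le> N"
    and q_neq: "exp \<eta> - exp (- \<eta>) \<noteq> 0"
    and generic_left: "qnum \<eta> (\<omega>1 + of_int m) \<noteq> 0"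
    and generic_right: "qnum \<eta> (\<omega>2 + 1) \<noteq> 0"
    and layer_relation: "x \<in> carrier A \<Longrightarrow>
      layer N (layer (Suc N) (layer N x)) = sc (b_weight N \<eta> \<omega>1 \<omega>2 \<theta>) (layer N x)"
    and v_fund: "\<exists>z\<in>carrier A. v (fund_path N) = tri N z"
    and v_tile: "adds_tile N i q p \<Longrightarrow>
      v p = (g i \<ominus> cst (r_fun \<eta> (tile_arg \<omega>1 (q ! (i - 1))))) \<otimes> v q"
    and v_half_tile: "adds_half_tile N q p \<Longrightarrow>
      v p = (g N \<ominus> cst (k_fun \<eta> \<omega>2 \<theta> (tile_arg \<omega>1 (q ! (N - 1))))) \<otimes> v q"
begin

section \<open>The subtracted scalars and the recursion for the vectors\<close>

definition coeff :: "nat \<Rightarrow> complex \<Rightarrow> complex" where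
  "coeff k u = (if k < N then r_fun \<eta> u else k_fun \<eta> \<omega>2 \<theta> u)"

lemma tile_arg_generic: "qnum \<eta> (tile_arg \<omega>1 h + of_int m) \<noteq> 0"
proof (cases "h \<ge> 0")
  case True
  then have "tile_arg \<omega>1 h + of_int m = \<omega>1 + of_int (m - h)" by (simp add: tile_arg_def)
  then show ?thesis by (metis generic_left)
next
  case False
  then have "tile_arg \<omega>1 h + of_int m = - (\<omega>1 + of_int (- m - h))" by (simp add: tile_arg_def)
  then show ?thesis by (metis generic_left qnum_minus neg_equal_0_iff_equal)
qed

lemma tile_arg_generics:
  "qnum \<eta> (tile_arg \<omega>1 h) \<noteq> 0" "qnum \<eta> (tile_arg \<omega>1 h - 1) \<noteq> 0" "qnum \<eta> (tile_arg \<omega>1 h + 1) \<noteq> 0"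
  using tile_arg_generic[of h 0] tile_arg_generic[of h "- 1"] tile_arg_generic[of h 1] by simp_all

lemma adds_N: "adds N k q p \<longleftrightarrow> is_path N q \<and> is_path N p \<and> 1 \<le> k \<and> k \<le> N \<and>
     (\<forall>j\<le>N. j \<noteq> k \<longrightarrow> p ! j = q ! j) \<and> (k < N \<longrightarrow> q ! (k - 1) = q ! (k + 1)) \<and>
     flips (q ! (k - 1)) (q ! k) (p ! k)"
  by (rule adds_iff[OF N_pos])

lemma v_closed [simp]: "is_path N p \<Longrightarrow> v p \<in> carrier A"
  using N_pos
proof (induction p rule: path_induct)
  case fund
  then show ?case using v_fund by auto
next
  case (adds p q k)
  have "v q \<in> carrier A" using adds adds_weight[OF N_pos adds(1)] by (auto simp: adds_N)
  then show ?case using adds(1) v_tile[of k q p] v_half_tile[of q p]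
    by (auto simp: adds_def adds_tile_def)
qed

lemma v_adds:
  assumes "adds N k q p"
  shows "v p = g k \<otimes> v q \<oplus> sc (- coeff k (tile_arg \<omega>1 (q ! (k - 1)))) (v q)"
proof -
  have "k \<le> N" "is_path N q" using assms by (auto simp: adds_N)
  then show ?thesis
    using assms v_tile[of k q p] v_half_tile[of q p] N_pos
    by (auto simp: adds_def coeff_def shifted_mult adds_tile_def)
qed

lemma s_nonzero: "loop_weight \<eta> \<omega>1 \<noteq> 0"
  using generic_left[of 0] generic_left[of 1] by (simp add: loop_weight_def)

lemma r_at_fund: "r_fun \<eta> \<omega>1 = 1 / loop_weight \<eta> \<omega>1" "r_fun \<eta> (- 1 - \<omega>1) = loop_weight \<eta> \<omega>1"
  using qnum_minus[of \<eta> \<omega>1] qnum_minus[of \<eta> "1 + \<omega>1"] by (simp_all add: add.commute r_fun_def loop_weight_def)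

text \<open>The scalar is the one subtracted by an addition at j: in the fundamental path the height
  at j - 1 equals that at i, also when i = j + 1. An addition at j therefore yields a vector killed
  by e_i.\<close>

lemma g_g_fund:
  assumes "i < N" "1 \<le> j" "j \<le> N" "j = i + 1 \<or> i = j + 1"
  shows "g i \<otimes> (g j \<otimes> v (fund_path N)) =
    sc (coeff j (tile_arg \<omega>1 (if even i then 0 else - 1))) (g i \<otimes> v (fund_path N))"
proof -
  obtain z where z: "z \<in> carrier A" "v (fund_path N) = tri N z" using v_fund by auto
  have sq: "sandwich_coeff i \<noteq> 0" using s_nonzero by (simp add: sandwich_coeff_def)
  have c: "x = sc (b / a) y" if "sc a x = sc b y" "a \<noteq> 0" "x \<in> carrier A" "y \<in> carrier A" for a b x y
    using sc_left_cancel that by blast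
  have tri: "tri N z \<in> carrier A" "g j \<otimes> tri N z \<in> carrier A" "g i \<otimes> tri N z \<in> carrier A"
    using z(1) assms by simp_all
  \<comment> \<open>On even i this is r(\<omega>1) = 1 / s, on odd i it is r(- 1 - \<omega>1) =
    s.\<close>
  have ratio: "sandwich_coeff j / sandwich_coeff i = coeff j (tile_arg \<omega>1 (if even i then 0 else - 1))"
    if "j < N"
    using that assms(4) by (auto simp: coeff_def tile_arg_def sandwich_coeff_def r_at_fund)
  consider "j = N" | "j < N" "i = 0" "j = 1" | "j < N" "1 \<le> i" "j = i + 1" | "j < N" "2 \<le> i" "i = j + 1"
    using assms by linarith
  then show ?thesis
    unfolding z(2)
  proof cases
    case 1
    then have i: "i = N - 1" using assms by auto
    have eq: "sc (sandwich_coeff i) (g i \<otimes> (g j \<otimes> tri N z)) =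
        sc (b_weight N \<eta> \<omega>1 \<omega>2 \<theta>) (g i \<otimes> tri N z)"
      unfolding 1 i by (rule g_right_tri[OF N_ge_2 z(1) layer_relation])
    have "b_weight N \<eta> \<omega>1 \<omega>2 \<theta> / sandwich_coeff i =
        coeff j (tile_arg \<omega>1 (if even i then 0 else - 1))"
      using 1 i N_pos s_nonzero generic_left[of 0] b_weight_even[of N \<eta> \<omega>1 \<omega>2 \<theta>]
        b_weight_odd[of N \<eta> \<omega>1 \<omega>2 \<theta>]
      by (cases "even N") (auto simp: coeff_def tile_arg_def sandwich_coeff_def)
    with c[OF eq sq] show "g i \<otimes> (g j \<otimes> tri N z) = sc (coeff j (tile_arg \<omega>1 (if even i then 0 else - 1))) (g i \<otimes> tri N z)"
      using assms tri by simp
  next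
    case 2
    obtain y where y: "y \<in> carrier A" "tri N z = tri 2 y" using tri_decompose[OF N_ge_2 _ z(1)] by auto
    have "sc (loop_weight \<eta> \<omega>1) (g i \<otimes> (g j \<otimes> tri N z)) = sc 1 (g i \<otimes> tri N z)"
      unfolding y(2) using g01_tri[OF _ y(1)] 2 y(1) N_ge_2 by simp
    from c[OF this s_nonzero] show "g i \<otimes> (g j \<otimes> tri N z) = sc (coeff j (tile_arg \<omega>1 (if even i then 0 else - 1))) (g i \<otimes> tri N z)"
      using 2 assms tri by (simp add: coeff_def tile_arg_def r_at_fund)
  next
    case 3
    obtain y where y: "y \<in> carrier A" "tri N z = tri (Suc (Suc i)) y"
      using tri_decompose[of "Suc (Suc i)" N z] z(1) 3 by auto
    have "sc (sandwich_coeff i) (g i \<otimes> (g j \<otimes> tri N z)) = sc (sandwich_coeff j) (g i \<otimes> tri N z)"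
      unfolding y(2) 3(3) using 3 y by (intro g_up_tri) auto
    from c[OF this sq] show "g i \<otimes> (g j \<otimes> tri N z) = sc (coeff j (tile_arg \<omega>1 (if even i then 0 else - 1))) (g i \<otimes> tri N z)"
      using 3 assms tri ratio by simp
  next
    case 4
    obtain y where y: "y \<in> carrier A" "tri N z = tri (Suc i) y"
      using tri_decompose[of "Suc i" N z] z(1) assms by auto
    have j: "j = i - 1" using 4 by simp
    have "sc (sandwich_coeff i) (g i \<otimes> (g j \<otimes> tri N z)) = sc (sandwich_coeff j) (g i \<otimes> tri N z)"
      unfolding y(2) j using 4 y assms by (intro g_down_tri) auto
    from c[OF this sq] show "g i \<otimes> (g j \<otimes> tri N z) = sc (coeff j (tile_arg \<omega>1 (if even i then 0 else - 1))) (g i \<otimes> tri N z)"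
      using 4 assms tri ratio by simp
  qed
qed

lemma g_shifted_swap:
  assumes "i \<le> N" "k \<le> N" "i + 1 < k \<or> k + 1 < i" "x \<in> carrier A"
  shows "g i \<otimes> (g k \<otimes> x \<oplus> sc c x) = g k \<otimes> (g i \<otimes> x) \<oplus> sc c (g i \<otimes> x)"
  using assms g_swap[OF assms] by (simp add: r_distr mult_sc)

text \<open>An addition at \<open>k\<close> moves the height at \<open>k\<close> out of \<open>{0, -1}\<close>, so no addition leading to \<open>q\<close> took
  place in the window, and all of them commute with \<open>g i\<close> and \<open>g j\<close>.\<close>

lemma g_g_flat:
  assumes "is_path N q" "i < N" "1 \<le> j" "j \<le> N" "j = i + 1 \<or> i = j + 1"
    and "\<And>m. m \<le> N \<Longrightarrow> min i j \<le> m + 1 \<Longrightarrow> m \<le> max i j + 1 \<Longrightarrow> q ! m = 0 \<or> q ! m = - 1"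
  shows "g i \<otimes> (g j \<otimes> v q) = sc (coeff j (tile_arg \<omega>1 (q ! i))) (g i \<otimes> v q)"
  using N_pos assms(1,6)
proof (induction q rule: path_induct)
  case fund
  show ?case using g_g_fund[OF assms(2-5)] assms(2) by (simp add: fund_path_nth)
next
  case (adds p q k)
  have k: "k \<le> N" "is_path N q" "\<And>j. j \<le> N \<Longrightarrow> j \<noteq> k \<Longrightarrow> p ! j = q ! j"
    "flips (q ! (k - 1)) (q ! k) (p ! k)"
    using adds(1) by (auto simp: adds_N)
  have "p ! k \<noteq> 0 \<and> p ! k \<noteq> - 1" using k(4) by (auto simp: flips_def)
  then have far: "k + 1 < min i j \<or> max i j + 1 < k" using adds.prems[of k] k(1) by linarith
  then have pq: "p ! i = q ! i" using k(3)[of i] assms(2) by auto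
  have "q ! m = 0 \<or> q ! m = - 1" if "m \<le> N" "min i j \<le> m + 1" "m \<le> max i j + 1" for m
    using adds.prems[of m] that k(3)[of m] far by force
  then have IH: "g i \<otimes> (g j \<otimes> v q) = sc (coeff j (tile_arg \<omega>1 (q ! i))) (g i \<otimes> v q)"
    using adds.IH[OF k(2) adds_weight[OF N_pos adds(1)]] by blast
  have f: "i + 1 < k \<or> k + 1 < i" "j + 1 < k \<or> k + 1 < j" using far by auto
  have c: "v q \<in> carrier A" "g i \<otimes> v q \<in> carrier A" "g j \<otimes> v q \<in> carrier A" using k(2) assms by simp_all
  show ?case
    unfolding v_adds[OF adds(1)] pq
    using assms k c f IH by (simp add: g_shifted_swap sc_plus g_sc mult.commute)
qed

text \<open>Additions at k \<ge> 2 commute with e_0 and keep h_1. An addition at 1 starts from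
  heights 0, -1, 0, so \<open>g_g_flat\<close> applies and its scalar is exactly the one
  subtracted.\<close>

lemma left_action:
  assumes "is_path N p"
  shows "(p ! 1 = - 1 \<longrightarrow> g 0 \<otimes> v p = sc (loop_weight \<eta> \<omega>1) (v p)) \<and>
    (p ! 1 = 1 \<longrightarrow> g 0 \<otimes> v p = \<zero>)"
  using N_pos assms
proof (induction p rule: path_induct)
  case fund
  obtain z where "z \<in> carrier A" "v (fund_path N) = tri N z" using v_fund by auto
  then show ?case using g0_tri[of N z] N_pos fund_path_nth[of 1 N] by simp
next
  case (adds p q k)
  have k: "1 \<le> k" "k \<le> N" "is_path N q" "\<And>j. j \<le> N \<Longrightarrow> j \<noteq> k \<Longrightarrow> p ! j = q ! j"
    "flips (q ! (k - 1)) (q ! k) (p ! k)" "k < N \<Longrightarrow> q ! (k - 1) = q ! (k + 1)"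
    using adds(1) by (auto simp: adds_N)
  have c: "v q \<in> carrier A" using k(3) by simp
  show ?case
  proof (cases "k = 1")
    case False
    then have far: "1 < k" "p ! 1 = q ! 1" using k N_ge_2 by auto
    note IH = adds.IH[OF k(3) adds_weight[OF N_pos adds(1)]]
    have *: "g 0 \<otimes> v p = g k \<otimes> (g 0 \<otimes> v q) \<oplus> sc (- coeff k (tile_arg \<omega>1 (q ! (k - 1)))) (g 0 \<otimes> v q)"
      unfolding v_adds[OF adds(1)] using far k c by (intro g_shifted_swap) auto
    show ?thesis
      unfolding * far(2) using IH k c
      by (auto simp: v_adds[OF adds(1)] sc_plus g_sc mult.commute)
  next
    case True
    have h: "q ! 0 = 0" using k(3) by (simp add: is_path_def)
    then have q: "q ! 1 = - 1" "p ! 1 = 1" "q ! 2 = 0"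
      using k(5,6) True N_ge_2 by (auto simp: flips_def numeral_2_eq_2)
    have "g 0 \<otimes> (g 1 \<otimes> v q) = sc (coeff 1 (tile_arg \<omega>1 (q ! 0))) (g 0 \<otimes> v q)"
    proof (rule g_g_flat[OF k(3)])
      fix m assume "m \<le> max 0 1 + (1::nat)"
      then have "m = 0 \<or> m = 1 \<or> m = 2" by auto
      then show "q ! m = 0 \<or> q ! m = - 1" using q h by auto
    qed (use N_ge_2 in auto)
    then have "g 0 \<otimes> v p = sc (coeff 1 (tile_arg \<omega>1 (q ! 0)) + - coeff 1 (tile_arg \<omega>1 (q ! 0))) (g 0 \<otimes> v q)"
      unfolding v_adds[OF adds(1)] True using c N_pos by (subst sc_add) (simp_all add: r_distr mult_sc)
    then show ?thesis using q c by simp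
  qed
qed

section \<open>Slopes are annihilated, and the two-dimensional blocks\<close>

lemma k_sum: "qnum \<eta> u \<noteq> 0 \<Longrightarrow> k_fun \<eta> \<omega>2 \<theta> u + k_fun \<eta> \<omega>2 \<theta> (- u) = loop_weight \<eta> \<omega>2"
  by (rule k_fun_sum[OF q_neq _ generic_right])

lemma g_twice_coeff:
  assumes "1 \<le> j" "j \<le> N" "x \<in> carrier A" "qnum \<eta> u \<noteq> 0"
  shows "g j \<otimes> (g j \<otimes> x) = sc (coeff j u + coeff j (- u)) (g j \<otimes> x)"
  using assms g_twice[of j x] gN_twice[of x] r_fun_sum[OF q_neq] k_sum
  by (cases "j = N") (auto simp: coeff_def)

text \<open>Supplies \<kappa> for the reflection equation. Either the last heights lie in {0, -1},
  or the last half-tile can be removed; this leaves a slope at N - 1, and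
  \<open>shifted_eigen\<close> applies. Vanishing on slopes is a hypothesis because the lemma is
  used inside the induction proving it.\<close>

lemma valley_action:
  assumes slope: "\<And>q. adds N N q p \<Longrightarrow> q ! N = q ! (N - 2) + 2 \<or> q ! N = q ! (N - 2) - 2 \<Longrightarrow>
      g (N - 1) \<otimes> v q = \<zero>"
    and p: "is_path N p" "p ! N = p ! (N - 2)"
    and valley: "flips (p ! (N - 2)) (p ! (N - 1)) h"
  shows "g (N - 1) \<otimes> (g N \<otimes> v p) =
    sc (coeff N (- tile_arg \<omega>1 (p ! (N - 2)) - 1)) (g (N - 1) \<otimes> v p)"
proof -
  let ?a = "p ! (N - 2)" and ?u = "tile_arg \<omega>1 (p ! (N - 2))"
  consider (flat) "?a = 0 \<and> p ! (N - 1) = - 1 \<or> ?a = - 1 \<and> p ! (N - 1) = 0"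
    | (top) "p ! (N - 1) \<ge> 0 \<and> p ! N = p ! (N - 1) + 1 \<or> p ! (N - 1) < 0 \<and> p ! N = p ! (N - 1) - 1"
    using valley p(2) unfolding flips_def by linarith
  then show ?thesis
  proof cases
    case flat
    \<comment> \<open>The map u to - u - 1 exchanges the arguments \<omega>1 and - \<omega>1 - 1 of
      the heights 0 and -1.\<close>
    have "- ?u - 1 = tile_arg \<omega>1 (p ! (N - 1))" using flat by (auto simp: tile_arg_def)
    moreover have "g (N - 1) \<otimes> (g N \<otimes> v p) = sc (coeff N (tile_arg \<omega>1 (p ! (N - 1)))) (g (N - 1) \<otimes> v p)"
    proof (rule g_g_flat[OF p(1)])
      fix m assume "m \<le> N" "min (N - 1) N \<le> m + 1"
      then have "m = N \<or> m = N - 1 \<or> m = N - 2" by auto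
      then show "p ! m = 0 \<or> p ! m = - 1" using flat p(2) by auto
    qed (use N_ge_2 in auto)
    ultimately show ?thesis by simp
  next
    case top
    obtain q where q: "adds N N q p" by (rule ex_adds[OF p(1) N_pos order_refl _ top]) simp
    have h: "q ! (N - 2) = ?a" "q ! (N - 1) = p ! (N - 1)" "is_path N q"
      "flips (q ! (N - 1)) (q ! N) (p ! N)"
      using q N_ge_2 by (auto simp: adds_N)
    have "q ! N = q ! (N - 2) + 2 \<or> q ! N = q ! (N - 2) - 2"
      using top h valley p(2) unfolding flips_def by linarith
    then have z: "g (N - 1) \<otimes> v q = \<zero>" by (rule slope[OF q])
    have "?a \<ge> 1 \<and> q ! (N - 1) = ?a - 1 \<or> ?a < - 1 \<and> q ! (N - 1) = ?a + 1"
      using top h(2) valley p(2) unfolding flips_def by linarith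
    \<comment> \<open>The height at N - 1 is one step closer to -1/2 than ?a and on the same
      side.\<close>
    then have u: "tile_arg \<omega>1 (q ! (N - 1)) = ?u + 1" by (elim disjE) (simp_all add: tile_arg_def)
    have sq: "g N \<otimes> (g N \<otimes> v q) = sc (coeff N (?u + 1) + coeff N (- ?u - 1)) (g N \<otimes> v q)"
      using g_twice_coeff[OF N_pos order_refl v_closed[OF h(3)] tile_arg_generics(3)[of ?a]]
      by (simp only: minus_add_distrib add_uminus_conv_diff)
    show ?thesis
      unfolding v_adds[OF q] u
      by (rule shifted_eigen[OF _ order_refl v_closed[OF h(3)] z sq]) simp
  qed
qed

text \<open>The position i varies in the induction, because removing two tiles can leave a slope at
  j instead of i. The last addition cannot be at i itself, as it would leave equal heights at i - 1
  and i + 1.\<close>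

lemma slope_action:
  assumes "is_path N p" "1 \<le> i" "i < N"
    and "p ! (i + 1) = p ! (i - 1) + 2 \<or> p ! (i + 1) = p ! (i - 1) - 2"
  shows "g i \<otimes> v p = \<zero>"
  using N_pos assms
proof (induction p arbitrary: i rule: path_induct)
  case fund
  then show ?case using fund_path_nth[of "i + 1" N] fund_path_nth[of "i - 1" N] by (auto split: if_splits)
next
  case (adds p q j)
  have j: "1 \<le> j" "j \<le> N" "is_path N q" "is_path N p" "\<And>m. m \<le> N \<Longrightarrow> m \<noteq> j \<Longrightarrow> p ! m = q ! m"
    "flips (q ! (j - 1)) (q ! j) (p ! j)" "j < N \<Longrightarrow> q ! (j - 1) = q ! (j + 1)"
    using adds(1) by (auto simp: adds_N)
  have i: "1 \<le> i" "i < N" and slope: "p ! (i + 1) = p ! (i - 1) + 2 \<or> p ! (i + 1) = p ! (i - 1) - 2"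
    using adds.prems by auto
  note lt = adds_weight[OF N_pos adds(1)]
  have x: "v q \<in> carrier A" "g i \<otimes> v q \<in> carrier A" "g j \<otimes> v q \<in> carrier A" using j(1-3) i by simp_all
  let ?c' = "coeff j (tile_arg \<omega>1 (q ! (j - 1)))"
  have "j \<noteq> i"
  proof
    assume "j = i"
    then show False using j(5)[of "i + 1"] j(5)[of "i - 1"] j(7) i slope by auto
  qed
  then consider (far) "i + 1 < j \<or> j + 1 < i" | (near) "j = i + 1 \<or> i = j + 1" by linarith
  then show ?case
  proof cases
    case far
    have "q ! (i + 1) = q ! (i - 1) + 2 \<or> q ! (i + 1) = q ! (i - 1) - 2"
      using slope far j(5)[of "i + 1"] j(5)[of "i - 1"] i by auto
    then have "g i \<otimes> v q = \<zero>" by (rule adds.IH[OF j(3) lt i])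
    then show ?thesis
      unfolding v_adds[OF adds(1)] using far i j(1,2) x by (simp add: g_shifted_swap)
  next
    case near
    define a h where "a = q ! (i - 1)" and "h = q ! i"
    \<comment> \<open>Before the addition, q has a peak or a valley at i, with height h there and a
      on both sides.\<close>
    have *: "flips h a (p ! j) \<and> q ! (i + 1) = a \<and> q ! (j - 1) = h"
      using near
    proof
      assume ji: "j = i + 1"
      then have e: "p ! (i - 1) = a" "p ! i = h" "q ! (j - 1) = h"
        using j(5)[of "i - 1"] j(5)[of i] i by (auto simp: a_def h_def)
      moreover have "p ! i = p ! (i - 1) + 1 \<or> p ! i = p ! (i - 1) - 1"
        using path_step[OF j(4), of "i - 1"] i by simp
      ultimately have "q ! j = a" using j(6) slope ji unfolding flips_def by auto
      then show ?thesis using j(6) e ji by simp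
    next
      assume ij: "i = j + 1"
      then have e: "p ! (i + 1) = q ! (i + 1)" "p ! i = h" "q ! j = a" "p ! (i - 1) = p ! j" "q ! (j - 1) = h"
        using j(5)[of "i + 1"] j(5)[of i] j(7) i by (auto simp: a_def h_def)
      moreover have "p ! (i + 1) = p ! i + 1 \<or> p ! (i + 1) = p ! i - 1"
        using path_step[OF j(4), of i] i by simp
      ultimately have "q ! (i + 1) = a" using j(6) slope unfolding flips_def by auto
      then show ?thesis using j(6) e by simp
    qed
    then have h: "flips h a (p ! j)" "q ! (i + 1) = a" "q ! (j - 1) = h" by blast+
    \<comment> \<open>Outside {0, -1} the height h is farther from -1/2 than a, so a tile at i can
      be removed from q.\<close>
    consider (flat) "(a = 0 \<or> a = - 1) \<and> (h = 0 \<or> h = - 1)" | (top) "a \<ge> 0 \<and> h = a + 1 \<or> a < 0 \<and> h = a - 1"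
      using h(1) unfolding flips_def by linarith
    then show ?thesis
    proof cases
      case flat
      have "g i \<otimes> (g j \<otimes> v q) = sc (coeff j (tile_arg \<omega>1 (q ! i))) (g i \<otimes> v q)"
      proof (rule g_g_flat[OF j(3) i(2) j(1,2) near])
        fix m assume m: "m \<le> N" "min i j \<le> m + 1" "m \<le> max i j + 1"
        have "q ! (j + 1) = h" if "j < N" using j(7)[OF that] h by simp
        moreover have "m = i \<or> m = i - 1 \<or> m = i + 1 \<or> m = j - 1 \<or> m = j + 1 \<and> j < N"
          using m near by auto
        ultimately show "q ! m = 0 \<or> q ! m = - 1"
          using flat h a_def h_def by auto
      qed
      then have "g i \<otimes> v p = sc (coeff j (tile_arg \<omega>1 h) + - coeff j (tile_arg \<omega>1 h)) (g i \<otimes> v q)"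
        unfolding v_adds[OF adds(1)] h(3) using x i j(2)
        by (subst sc_add) (simp_all add: r_distr mult_sc h_def)
      then show ?thesis using x by simp
    next
      case top
      let ?u = "tile_arg \<omega>1 a"
      obtain q' where q': "adds N i q' q"
        by (rule ex_adds[OF j(3), of i]) (use i top h in \<open>auto simp: a_def h_def\<close>)
      have h': "is_path N q'" "q' ! (i - 1) = a" "q' ! (i + 1) = a" "flips a (q' ! i) h"
          "\<And>m. m \<le> N \<Longrightarrow> m \<noteq> i \<Longrightarrow> q' ! m = q ! m"
        using q' i h(2) by (auto simp: adds_N a_def h_def)
      note lt' = less_trans[OF adds_weight[OF N_pos q'] lt]
      have u: "tile_arg \<omega>1 h = ?u - 1" using top by (auto simp: tile_arg_def)
      have ci: "coeff i ?u = r_fun \<eta> ?u" using i by (simp add: coeff_def)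
      have r: "qnum \<eta> 2 - r_fun \<eta> ?u = r_fun \<eta> (- ?u)"
        using r_fun_sum[OF q_neq tile_arg_generics(1), of a] by (simp add: algebra_simps)
      \<comment> \<open>For j < N the path q' has a slope at j, so e_j kills its vector; for j = N
        the value comes from \<open>valley_action\<close>.\<close>
      define \<kappa> where "\<kappa> = (if j = N then coeff N (- ?u - 1) else 0)"
      have "g i \<otimes> (g j \<otimes> v q') = sc \<kappa> (g i \<otimes> v q')"
      proof (cases "j = N")
        case True
        then have iN: "i = N - 1" "i - 1 = N - 2" "i + 1 = N" using near i by auto
        have "g (N - 1) \<otimes> (g N \<otimes> v q') =
            sc (coeff N (- tile_arg \<omega>1 (q' ! (N - 2)) - 1)) (g (N - 1) \<otimes> v q')"
        proof (rule valley_action)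
          fix q'' assume q'': "adds N N q'' q'"
            and sl: "q'' ! N = q'' ! (N - 2) + 2 \<or> q'' ! N = q'' ! (N - 2) - 2"
          have "is_path N q''" using q'' by (simp add: adds_N)
          then show "g (N - 1) \<otimes> v q'' = \<zero>"
            using adds.IH[OF _ less_trans[OF adds_weight[OF N_pos q''] lt'] i] sl iN by simp
        next
          show "flips (q' ! (N - 2)) (q' ! (N - 1)) h" using h' iN by metis
        qed (use h' iN in auto)
        then show ?thesis using True iN h'(2) by (simp add: \<kappa>_def)
      next
        case False
        then have jN: "j < N" using j(2) by simp
        have "q' ! (j + 1) = q' ! (j - 1) + 2 \<or> q' ! (j + 1) = q' ! (j - 1) - 2"
          using near
        proof
          assume "j = i + 1"
          then show ?thesis using h'(4) h'(5)[of "j + 1"] j(7)[OF jN] h(3) jN by (auto simp: flips_def)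
        next
          assume "i = j + 1"
          then show ?thesis using h'(4) h'(5)[of "j - 1"] h(3) jN by (auto simp: flips_def)
        qed
        then have "g j \<otimes> v q' = \<zero>" by (rule adds.IH[OF h'(1) lt' j(1) jN])
        then show ?thesis using h'(1) False i by (simp add: \<kappa>_def)
      qed
      \<comment> \<open>For j < N this is unitarity of r, for j = N the reflection identity.\<close>
      moreover have "1 - r_fun \<eta> ?u * \<kappa> - coeff j (?u - 1) * (qnum \<eta> 2 - r_fun \<eta> ?u) = 0"
        unfolding r \<kappa>_def coeff_def
        using r_fun_unitarity[OF tile_arg_generics(1,2), of a] j(2)
          reflection_identity[OF q_neq generic_right tile_arg_generics(1,3,2), of a \<theta>]
        by (simp add: algebra_simps)
      ultimately show ?thesis
        unfolding v_adds[OF adds(1)] v_adds[OF q'] h(3) u h'(2) ci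
        by (intro slope_vanish i j(2) near v_closed h'(1))
    qed
  qed
qed

lemma adds_action:
  assumes "adds N j q p"
  defines "u \<equiv> tile_arg \<omega>1 (q ! (j - 1))"
  shows "g j \<otimes> v q = sc (coeff j u) (v q) \<oplus> sc 1 (v p)"
    "g j \<otimes> v p = sc (coeff j u * coeff j (- u)) (v q) \<oplus> sc (coeff j (- u)) (v p)"
proof -
  have j: "1 \<le> j" "j \<le> N" "v q \<in> carrier A" using assms(1) by (simp_all add: adds_N)
  have "g j \<otimes> (g j \<otimes> v q) = sc (coeff j u + coeff j (- u)) (g j \<otimes> v q)"
    unfolding u_def by (rule g_twice_coeff[OF j tile_arg_generics(1)])
  note two_by_two[OF j(2,3) this]
  then show "g j \<otimes> v q = sc (coeff j u) (v q) \<oplus> sc 1 (v p)"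
    "g j \<otimes> v p = sc (coeff j u * coeff j (- u)) (v q) \<oplus> sc (coeff j (- u)) (v p)"
    unfolding v_adds[OF assms(1)] u_def .
qed

end

section \<open>The double quotient\<close>

context
  fixes N :: nat and \<eta> \<omega>1 \<omega>2 \<theta> :: complex
  assumes N: "1 \<le> N"
begin

private abbreviation (input) "A \<equiv> dq N \<eta> \<omega>1 \<omega>2 \<theta>"
private abbreviation (input) "F \<equiv> free_algebra N"
private abbreviation (input) "cl \<equiv> dq_class N \<eta> \<omega>1 \<omega>2 \<theta>"
private abbreviation (input) "e \<equiv> dq_gen N \<eta> \<omega>1 \<omega>2 \<theta>"
private abbreviation (input) "cst \<equiv> dq_const N \<eta> \<omega>1 \<omega>2 \<theta>"

section \<open>The abstract relations hold in the double quotient\<close>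

lemma dq_class_mult:
  "f \<in> carrier F \<Longrightarrow> h \<in> carrier F \<Longrightarrow> cl (f * h) = cl f \<otimes>\<^bsub>A\<^esub> cl h"
  using ring_hom_mult[OF dq_class_hom[OF N]] by simp

lemma dq_boundary_tl:
  "boundary_tl A N e cst (qnum \<eta> 2) (loop_weight \<eta> \<omega>1) (loop_weight \<eta> \<omega>2)"
proof -
  interpret A: ring A by (rule ring_dq[OF N])
  note closed = free_closed free_base_closed
  note eq = dq_class_eqI_tbtl[OF N]
  show ?thesis
  proof
    fix a b :: complex
    have "fconst (a + b) = fconst a + fconst b" by (simp add: fconst_def single_add)
    then show "cst (a + b) = cst a \<oplus>\<^bsub>A\<^esub> cst b"
      using ring_hom_add[OF dq_class_hom[OF N], of "fconst a" "fconst b"]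
      by (simp add: dq_const_def closed)
    have "fconst (a * b) = fconst a * fconst b" by (simp add: fconst_def mult_single)
    then show "cst (a * b) = cst a \<otimes>\<^bsub>A\<^esub> cst b" by (simp add: dq_const_def closed dq_class_mult)
    have "fconst 1 = 1" by (simp add: fconst_def)
    then show "cst 1 = \<one>\<^bsub>A\<^esub>"
      using ring_hom_one[OF dq_class_hom[OF N]] by (simp add: dq_const_def)
  next
    fix i j assume ij: "1 \<le> i" "i < N" "j = i + 1 \<or> i = j + 1"
    have "fgen i * fgen j * fgen i - fgen i \<in> tbtl_relations N \<eta> \<omega>1 \<omega>2"
      unfolding tbtl_relations_def
      by (rule UnI1, rule UnI1, rule UnI2, rule CollectI) (use ij in \<open>intro exI conjI refl; auto\<close>)
    moreover have "i \<le> N" "j \<le> N" using ij by auto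
    moreover from calculation have "cl (fgen i * fgen j * fgen i) = cl (fgen i)"
      by (intro eq closed)
    ultimately show "e i \<otimes>\<^bsub>A\<^esub> e j \<otimes>\<^bsub>A\<^esub> e i = e i"
      by (simp add: dq_gen_def closed dq_class_mult)
  next
    fix i assume i: "1 \<le> i" "i < N"
    have "fgen i * fgen i - fconst (qnum \<eta> 2) * fgen i \<in> tbtl_relations N \<eta> \<omega>1 \<omega>2"
      unfolding tbtl_relations_def
      by (rule UnI1, rule UnI1, rule UnI1, rule CollectI) (use i in \<open>intro exI[of _ i]; auto\<close>)
    then have "cl (fgen i * fgen i) = cl (fconst (qnum \<eta> 2) * fgen i)"
      using i by (intro eq closed) auto
    then show "e i \<otimes>\<^bsub>A\<^esub> e i = cst (qnum \<eta> 2) \<otimes>\<^bsub>A\<^esub> e i"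
      using i by (simp add: dq_gen_def dq_const_def closed dq_class_mult)
  next
    have "cl (fgen 0 * fgen 0) = cl (fconst (loop_weight \<eta> \<omega>1) * fgen 0)"
      by (intro eq closed) (simp_all add: tbtl_relations_def)
    then show "e 0 \<otimes>\<^bsub>A\<^esub> e 0 = cst (loop_weight \<eta> \<omega>1) \<otimes>\<^bsub>A\<^esub> e 0"
      by (simp add: dq_gen_def dq_const_def closed dq_class_mult)
  next
    have "cl (fgen N * fgen N) = cl (fconst (loop_weight \<eta> \<omega>2) * fgen N)"
      by (intro eq closed) (simp_all add: tbtl_relations_def)
    then show "e N \<otimes>\<^bsub>A\<^esub> e N = cst (loop_weight \<eta> \<omega>2) \<otimes>\<^bsub>A\<^esub> e N"
      by (simp add: dq_gen_def dq_const_def closed dq_class_mult)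
  qed (use N dq_closed[OF N] dq_const_central[OF N] dq_gen_commute[OF N] in auto)
qed

lemma dq_class_eqI_dq:
  assumes "f \<in> carrier F" "h \<in> carrier F"
    and "tbtl_class N \<eta> \<omega>1 \<omega>2 (f - h) \<in> dq_relations N \<eta> \<omega>1 \<omega>2 \<theta>"
  shows "cl f = cl h"
proof -
  let ?T = "tbtl N \<eta> \<omega>1 \<omega>2" and ?c = "tbtl_class N \<eta> \<omega>1 \<omega>2"
  interpret T: ring ?T by (rule ring_tbtl[OF N])
  note hom = tbtl_class_hom[OF N]
  have d: "f - h \<in> carrier F" using assms by (intro free_closed)
  have c: "?c f \<in> carrier ?T" "?c h \<in> carrier ?T" "?c (f - h) \<in> carrier ?T"
    using assms d by (auto intro: ring_hom_closed[OF hom])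
  have "?c f = ?c (f - h) \<oplus>\<^bsub>?T\<^esub> ?c h"
    using ring_hom_add[OF hom d assms(2)] by simp
  then have "?c f \<ominus>\<^bsub>?T\<^esub> ?c h = ?c (f - h)"
    using c by (simp add: T.minus_eq T.a_assoc T.r_neg)
  then show ?thesis
    unfolding dq_class_def dq_ideal_def
    using assms(3) c by (intro quot_eq ring_tbtl N dq_relations_closed) simp_all
qed

interpretation boundary_tl A N e cst "qnum \<eta> 2" "loop_weight \<eta> \<omega>1" "loop_weight \<eta> \<omega>2"
  by (rule dq_boundary_tl)

lemma sc_eq_dq_scale: "sc = dq_scale N \<eta> \<omega>1 \<omega>2 \<theta>"
  by (simp add: fun_eq_iff sc_def dq_scale_def)

text \<open>The word of M_k: the indices below k of parity opposite to k, in the increasing order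
  used for I_1 and I_2.\<close>

private definition word_of :: "nat \<Rightarrow> ncpoly" where
  "word_of k = prod_list (map fgen (filter (\<lambda>j. odd (j + k)) [0..<k]))"

private lemma word_of_closed: "k \<le> Suc N \<Longrightarrow> word_of k \<in> carrier F"
  unfolding word_of_def by (rule prod_fgen_closed) auto

private lemma layer_eq_word:
  "k \<le> Suc N \<Longrightarrow> x \<in> carrier A \<Longrightarrow> layer k x = cl (word_of k) \<otimes>\<^bsub>A\<^esub> x"
proof (induction k x rule: layer.induct)
  case (1 x)
  then show ?case using ring_hom_one[OF dq_class_hom[OF N]] by (simp add: word_of_def)
next
  case (2 x)
  then show ?case by (simp add: word_of_def flip: dq_gen_def)
next
  case (3 k x)
  have "word_of (Suc (Suc k)) = word_of k * fgen (Suc k)" by (simp add: word_of_def)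
  moreover have "cl (word_of k) \<in> carrier A" "cl (fgen (Suc k)) \<in> carrier A"
    using 3 by (auto intro!: ring_hom_closed[OF dq_class_hom[OF N]] word_of_closed free_base_closed)
  ultimately show ?case
    using 3 by (simp add: dq_class_mult word_of_closed free_base_closed m_assoc flip: dq_gen_def)
qed

private lemma words_eq:
  "even N \<Longrightarrow> word_of N = I1_word N" "even N \<Longrightarrow> word_of (Suc N) = I2_word N"
  "odd N \<Longrightarrow> word_of N = I2_word N" "odd N \<Longrightarrow> word_of (Suc N) = I1_word N"
  by (simp_all add: word_of_def I1_word_def I2_word_def)

text \<open>For even N this is I_1 I_2 I_1 = b I_1, for odd N it is I_2 I_1 I_2 = b I_2.\<close>

lemma dq_layer_relation:
  assumes "x \<in> carrier A"
  shows "layer N (layer (Suc N) (layer N x)) = sc (b_weight N \<eta> \<omega>1 \<omega>2 \<theta>) (layer N x)"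
proof -
  let ?v = "word_of N" and ?w = "word_of (Suc N)" and ?b = "fconst (b_weight N \<eta> \<omega>1 \<omega>2 \<theta>)"
  have F: "?v \<in> carrier F" "?w \<in> carrier F" "?b \<in> carrier F"
    by (simp_all add: word_of_closed free_base_closed)
  have A: "cl ?v \<in> carrier A" "cl ?w \<in> carrier A" "cl ?b \<in> carrier A"
    using F by (auto intro: ring_hom_closed[OF dq_class_hom[OF N]])
  have "cl (?v * ?w * ?v) = cl (?b * ?v)"
    using F by (intro dq_class_eqI_dq free_closed)
      (cases "even N"; simp add: dq_relations_def Let_def words_eq)+
  then show ?thesis
    using F A assms
    by (simp add: layer_eq_word sc_def dq_const_def dq_class_mult free_closed flip: m_assoc)
qed

lemma idem_eq_tri: "\<exists>z\<in>carrier A. idem N \<eta> \<omega>1 \<omega>2 \<theta> N = tri N z"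
  by (rule idem_factor) (simp_all add: sc_eq_dq_scale)

end

theorem theorem5p9:
  fixes N :: nat and \<eta> \<omega>1 \<omega>2 \<theta> :: complex
  assumes N: "N \<ge> 2"
    and q_not_root_of_unity: "\<And>n::nat. n \<ge> 1 \<Longrightarrow> exp \<eta> ^ n \<noteq> 1"
    and generic_1: "\<And>m::int. qnum \<eta> (\<omega>1 - of_int m) \<noteq> 0"
    and generic_2: "qnum \<eta> \<omega>2 \<noteq> 0" "qnum \<eta> (\<omega>2 + 1) \<noteq> 0"
  shows
    "let A = dq N \<eta> \<omega>1 \<omega>2 \<theta>;
         e = dq_gen N \<eta> \<omega>1 \<omega>2 \<theta>;
         scale = dq_scale N \<eta> \<omega>1 \<omega>2 \<theta>;
         b = basis_vec N \<eta> \<omega>1 \<omega>2 \<theta>;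
         mat = has_matrix N \<eta> \<omega>1 \<omega>2 \<theta>;
         r = r_fun \<eta>;
         k = k_fun \<eta> \<omega>2 \<theta>
     in
      (\<forall>p. is_path N p \<longrightarrow>
        (p ! 1 = - 1 \<longrightarrow>
          e 0 \<otimes>\<^bsub>A\<^esub> b p = scale (qnum \<eta> \<omega>1 / qnum \<eta> (\<omega>1 + 1)) (b p)) \<and>
        (p ! 1 = 1 \<longrightarrow> e 0 \<otimes>\<^bsub>A\<^esub> b p = \<zero>\<^bsub>A\<^esub>)) \<and>
      (\<forall>p i. is_path N p \<and> 1 \<le> i \<and> i \<le> N - 1 \<and>
          (p ! (i + 1) = p ! (i - 1) + 2 \<or> p ! (i + 1) = p ! (i - 1) - 2) \<longrightarrow>
        e i \<otimes>\<^bsub>A\<^esub> b p = \<zero>\<^bsub>A\<^esub>) \<and>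
      (\<forall>p p' i. adds_tile N i p p' \<longrightarrow>
        (let u = \<omega>1 - of_int (p ! (i - 1)); u' = - \<omega>1 + of_int (p ! (i - 1)) in
          (p ! (i - 1) \<ge> 0 \<longrightarrow> mat (e i) (b p) (b p') (r u) (r u * r u') 1 (r u')) \<and>
          (p ! (i - 1) < 0 \<longrightarrow> mat (e i) (b p) (b p') (r u') (r u * r u') 1 (r u)))) \<and>
      (\<forall>p p'. adds_half_tile N p p' \<longrightarrow>
        (let u = \<omega>1 - of_int (p ! (N - 1)); u' = - \<omega>1 + of_int (p ! (N - 1)) in
          (p ! (N - 1) \<ge> 0 \<longrightarrow> mat (e N) (b p) (b p') (k u) (k u * k u') 1 (k u')) \<and>
          (p ! (N - 1) < 0 \<longrightarrow> mat (e N) (b p) (b p') (k u') (k u * k u') 1 (k u))))"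
proof -
  have N1: "1 \<le> N" using N by simp
  interpret B: boundary_tl "dq N \<eta> \<omega>1 \<omega>2 \<theta>" N "dq_gen N \<eta> \<omega>1 \<omega>2 \<theta>" "dq_const N \<eta> \<omega>1 \<omega>2 \<theta>"
    "qnum \<eta> 2" "loop_weight \<eta> \<omega>1" "loop_weight \<eta> \<omega>2"
    by (rule dq_boundary_tl[OF N1])
  interpret path_module "dq N \<eta> \<omega>1 \<omega>2 \<theta>" N "dq_gen N \<eta> \<omega>1 \<omega>2 \<theta>" "dq_const N \<eta> \<omega>1 \<omega>2 \<theta>"
    \<eta> \<omega>1 \<omega>2 \<theta> "basis_vec N \<eta> \<omega>1 \<omega>2 \<theta>"
  proof
    show "2 \<le> N" by (rule N)
    show "exp \<eta> - exp (- \<eta>) \<noteq> 0"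
    proof
      assume "exp \<eta> - exp (- \<eta>) = 0"
      then have "exp \<eta> ^ 2 = exp \<eta> * exp (- \<eta>)" by (simp add: power2_eq_square)
      then show False using q_not_root_of_unity[of 2] by (simp flip: exp_add)
    qed
    show "qnum \<eta> (\<omega>1 + of_int m) \<noteq> 0" for m using generic_1[of "- m"] by simp
    show "qnum \<eta> (\<omega>2 + 1) \<noteq> 0" by (rule generic_2)
    show "\<exists>z\<in>carrier (dq N \<eta> \<omega>1 \<omega>2 \<theta>). basis_vec N \<eta> \<omega>1 \<omega>2 \<theta> (fund_path N) = B.tri N z"
      unfolding basis_vec_fund[OF N1] by (rule idem_eq_tri[OF N1])
  qed (use dq_layer_relation[OF N1] basis_vec_tile[OF N1] basis_vec_half_tile[OF N1]
      in \<open>simp_all add: R_op_def K_op_def\<close>)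
  have mat: "has_matrix N \<eta> \<omega>1 \<omega>2 \<theta> (dq_gen N \<eta> \<omega>1 \<omega>2 \<theta> i)
      (basis_vec N \<eta> \<omega>1 \<omega>2 \<theta> p) (basis_vec N \<eta> \<omega>1 \<omega>2 \<theta> p')
      (coeff i u) (coeff i u * coeff i (- u)) 1 (coeff i (- u))"
    if "adds N i p p'" "u = tile_arg \<omega>1 (p ! (i - 1))" for i p p' u
    using adds_action[OF that(1)] unfolding has_matrix_def that(2) sc_eq_dq_scale[OF N1] by blast
  have 1: "\<forall>p. is_path N p \<longrightarrow>
      (p ! 1 = - 1 \<longrightarrow> dq_gen N \<eta> \<omega>1 \<omega>2 \<theta> 0 \<otimes>\<^bsub>dq N \<eta> \<omega>1 \<omega>2 \<theta>\<^esub> basis_vec N \<eta> \<omega>1 \<omega>2 \<theta> p =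
        dq_scale N \<eta> \<omega>1 \<omega>2 \<theta> (qnum \<eta> \<omega>1 / qnum \<eta> (\<omega>1 + 1)) (basis_vec N \<eta> \<omega>1 \<omega>2 \<theta> p)) \<and>
      (p ! 1 = 1 \<longrightarrow> dq_gen N \<eta> \<omega>1 \<omega>2 \<theta> 0 \<otimes>\<^bsub>dq N \<eta> \<omega>1 \<omega>2 \<theta>\<^esub> basis_vec N \<eta> \<omega>1 \<omega>2 \<theta> p =
        \<zero>\<^bsub>dq N \<eta> \<omega>1 \<omega>2 \<theta>\<^esub>)"
    using left_action unfolding loop_weight_def[symmetric] sc_eq_dq_scale[OF N1] by blast
  \<comment> \<open>The function c stands for r or k. For h < 0 the tile argument is the negative of
    \<omega>1 - h, which exchanges the diagonal entries.\<close>
  have 3: "(h \<ge> 0 \<longrightarrow> has_matrix N \<eta> \<omega>1 \<omega>2 \<theta> (dq_gen N \<eta> \<omega>1 \<omega>2 \<theta> i)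
        (basis_vec N \<eta> \<omega>1 \<omega>2 \<theta> p) (basis_vec N \<eta> \<omega>1 \<omega>2 \<theta> p')
        (c (\<omega>1 - of_int h)) (c (\<omega>1 - of_int h) * c (- \<omega>1 + of_int h)) 1
        (c (- \<omega>1 + of_int h))) \<and>
      (h < 0 \<longrightarrow> has_matrix N \<eta> \<omega>1 \<omega>2 \<theta> (dq_gen N \<eta> \<omega>1 \<omega>2 \<theta> i)
        (basis_vec N \<eta> \<omega>1 \<omega>2 \<theta> p) (basis_vec N \<eta> \<omega>1 \<omega>2 \<theta> p')
        (c (- \<omega>1 + of_int h)) (c (\<omega>1 - of_int h) * c (- \<omega>1 + of_int h)) 1
        (c (\<omega>1 - of_int h)))"
    if "adds N i p p'" "h = p ! (i - 1)" "c = coeff i" for i p p' h c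
  proof (cases "h \<ge> 0")
    case True
    then have "\<omega>1 - of_int h = tile_arg \<omega>1 (p ! (i - 1))" using that(2) by (simp add: tile_arg_def)
    from mat[OF that(1) this] show ?thesis unfolding that(3) using True by simp
  next
    case False
    then have "- \<omega>1 + of_int h = tile_arg \<omega>1 (p ! (i - 1))" using that(2) by (simp add: tile_arg_def)
    from mat[OF that(1) this] show ?thesis unfolding that(3) using False by (simp add: mult.commute)
  qed
  have 4: "i < N \<and> adds N i p p'" if "adds_tile N i p p'" for i p p'
    using that N by (auto simp: adds_def adds_tile_def)
  have 5: "adds N N p p'" if "adds_half_tile N p p'" for p p'
    using that by (simp add: adds_def)
  have 6: "coeff i = r_fun \<eta>" if "i < N" for i
    using that by (simp add: coeff_def fun_eq_iff)
  have 7: "coeff N = k_fun \<eta> \<omega>2 \<theta>"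
    by (simp add: coeff_def fun_eq_iff)
  have 2: "\<forall>p i. is_path N p \<and> 1 \<le> i \<and> i \<le> N - 1 \<and>
      (p ! (i + 1) = p ! (i - 1) + 2 \<or> p ! (i + 1) = p ! (i - 1) - 2) \<longrightarrow>
      dq_gen N \<eta> \<omega>1 \<omega>2 \<theta> i \<otimes>\<^bsub>dq N \<eta> \<omega>1 \<omega>2 \<theta>\<^esub> basis_vec N \<eta> \<omega>1 \<omega>2 \<theta> p = \<zero>\<^bsub>dq N \<eta> \<omega>1 \<omega>2 \<theta>\<^esub>"
    by (intro allI impI slope_action) (use N in linarith)+
  show ?thesis
    unfolding Let_def
    by (rule conjI[OF 1 conjI[OF 2 conjI]]; intro allI impI)
      (rule 3[where c = "r_fun \<eta>"], (auto dest: 4 simp: 6)[3],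
       rule 3[where c = "k_fun \<eta> \<omega>2 \<theta>"], auto dest: 5 simp: 7)
qed

end
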